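(* Let $p,q\in[1,\infty)$, let $\Lambda=(\lambda_i)_{i\ge1}$ be a nondecreasing sequence of positive real numbers with $\sum_{i=1}^\infty \frac1{\lambda_i}=+\infty$, and let $\omega:[0,1]\to\mathbb R$ be a modulus of continuity. Then the inclusion $\Lambda BV^{(p)}\subset H_{\omega}^{q}$ holds if and only if $$\limsup_{n\to\infty}\left\{\frac{1}{\omega(1/n)\,n^{1/q}}\ \max_{1\le k\le n}\ \frac{k^{1/q}}{\left(\sum_{i=1}^{k}\frac1{\lambda_i}\right)^{1/p}}\right\}<+\infty .$$
   Context: For $f:[0,1]\to\mathbb R$ and an interval $I\subset[0,1]$, write $f(I):=f(\sup I)-f(\inf I)$. Put $$V(f):=\sup\left(\sum_{i=1}^n\frac{|f(I_i)|^p}{\lambda_i}\right)^{1/p},$$ where the supremum is over all finite (ordered) families $\{I_i\}_{i=1}^n$ of nonoverlapping subintervals of $[0,1]$. The Waterman-Shiba class $\Lambda BV^{(p)}$ is the linear space of all functions $f:[0,1]\to\mathbb R$ with $V(f)<+\infty$. (Such functions are regulated, hence bounded and integrable.) A modulus of continuity is a function $\omega:[0,1]\to\mathbb R$ that is nondecreasing, continuous, and satisfies $\omega(0)=0$. In the displayed condition, if $\omega(1/n)=0$ then the quotient is read as $+\infty$. For $f\in L^q[0,1]$ and $0\le\delta\le1$, the integral modulus of continuity is $$\omega_q(\delta,f):=\sup_{0\le\gamma\le\delta}\left(\int_0^{1-\gamma}|f(t+\gamma)-f(t)|^q\,dt\right)^{1/q}.$$ $H_{\omega}^{q}$ is the class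 of all $f\in L^q[0,1]$ for which $\omega_q(\delta,f)=O(\omega(\delta))$ as $\delta\to0+$. *)

theory Defs
  imports "HOL-Analysis.Analysis" "HOL-Library.Landau_Symbols"
begin

text \<open>
  A function on [0,1] is represented by a function of type real to real; its values outside [0,1]
  are never used. Sequences such as \<Lambda> are indexed from 1, and their value at 0 is never used.
\<close>

definition increment :: "(real \<Rightarrow> real) \<Rightarrow> real set \<Rightarrow> real" where
  "increment f I = f (Sup I) - f (Inf I)"

text \<open>
  Intervals of any kind (open, closed, half-open, degenerate) are allowed. The empty set is
  excluded because it has no endpoints. Nonoverlapping means having disjoint interiors.
\<close>

definition nonoverlapping_family :: "nat \<Rightarrow> (nat \<Rightarrow> real set) \<Rightarrow> bool" where
  "nonoverlapping_family n I \<longleftrightarrow>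
     (\<forall>i\<in>{1..n}. is_interval (I i) \<and> I i \<noteq> {} \<and> I i \<subseteq> {0..1}) \<and>
     disjoint_family_on (\<lambda>i. interior (I i)) {1..n}"

text \<open>The variation is an extended real, so that the supremum always makes sense.\<close>

definition WS_variation :: "(nat \<Rightarrow> real) \<Rightarrow> real \<Rightarrow> (real \<Rightarrow> real) \<Rightarrow> ereal" where
  "WS_variation \<Lambda> p f =
     (SUP (n, I) \<in> {(n, I). nonoverlapping_family n I}.
        ereal ((\<Sum>i=1..n. \<bar>increment f (I i)\<bar> powr p / \<Lambda> i) powr (1 / p)))"

definition Waterman_Shiba :: "(nat \<Rightarrow> real) \<Rightarrow> real \<Rightarrow> (real \<Rightarrow> real) set" where
  "Waterman_Shiba \<Lambda> p = {f. WS_variation \<Lambda> p f < \<infinity>}"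

definition modulus_of_continuity :: "(real \<Rightarrow> real) \<Rightarrow> bool" where
  "modulus_of_continuity \<omega> \<longleftrightarrow>
     mono_on {0..1} \<omega> \<and> continuous_on {0..1} \<omega> \<and> \<omega> 0 = 0"

text \<open>Membership in the q-th Lebesgue space of [0,1], for functions rather than a.e. classes.\<close>

definition Lq01 :: "real \<Rightarrow> (real \<Rightarrow> real) set" where
  "Lq01 q = {f. f \<in> borel_measurable (lebesgue_on {0..1}) \<and>
                integrable (lebesgue_on {0..1}) (\<lambda>t. \<bar>f t\<bar> powr q)}"

text \<open>
  Meant for f in \<^term>\<open>Lq01 q\<close> with q at least 1 and \<delta> between 0 and 1. The integrals then exist
  and are bounded uniformly in \<gamma> (Minkowski), so that the real-valued supremum is the intended one.
\<close>

definition integral_modulus :: "real \<Rightarrow> real \<Rightarrow> (real \<Rightarrow> real) \<Rightarrow> real" where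
  "integral_modulus q \<delta> f =
     (SUP \<gamma>\<in>{0..\<delta>}.
        (LINT t|lebesgue_on {0..1 - \<gamma>}. \<bar>f (t + \<gamma>) - f t\<bar> powr q) powr (1 / q))"

definition H_class :: "(real \<Rightarrow> real) \<Rightarrow> real \<Rightarrow> (real \<Rightarrow> real) set" where
  "H_class \<omega> q = {f \<in> Lq01 q. (\<lambda>\<delta>. integral_modulus q \<delta> f) \<in> O[at_right 0](\<omega>)}"

end

theory Submission
  imports Defs
begin

text \<open>
  Write \<open>S\<^sub>k\<close> for \<open>1 / \<Lambda>\<^sub>1 + \<dots> + 1 / \<Lambda>\<^sub>k\<close> and \<open>W\<^sub>n\<close> for the maximum in the criterion; these are \<open>recip_sum k\<close>
  and \<open>max_ratio n\<close> below. The criterion says that \<open>n powr (- 1 / q) W\<^sub>n = O(\<omega> (1 / n))\<close>.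

  Sufficiency rests on the extremal problem \<open>sum_powr_le_of_decreasing_weighted_sum\<close>. The increments of
  \<open>f\<close> along a grid \<open>t, t + \<gamma>, t + 2\<gamma>, \<dots>\<close> with \<open>N\<close> steps, listed in decreasing order, have \<open>p\<close>-th
  powers \<open>y\<^sub>i\<close> with \<open>\<Sum> y\<^sub>i / \<Lambda>\<^sub>i\<close> bounded by the variation. Under this constraint the sum of their \<open>q\<close>-th powers,
  \<open>\<Sum> y\<^sub>i powr (q / p)\<close>, is largest when a number \<open>k \<le> N\<close> of increments are equal and the others vanish. Hence it is at
  most a constant times \<open>W\<^sub>N powr q\<close>. Integrating over \<open>t\<close> in one period \<open>[0, \<gamma>)\<close>, where \<open>\<gamma>\<close> is about
  \<open>1 / N\<close>, bounds the integral modulus of continuity by a multiple of \<open>N powr (- 1 / q) W\<^sub>N\<close>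
  (\<open>integral_modulus_le\<close>). This quantity decreases in \<open>N\<close>, so smaller translations do no harm. The integrals make
  sense because a function of finite variation has only countably many discontinuities
  (\<open>finite_large_oscillation\<close>), a consequence of the divergence of \<open>\<Sum> 1 / \<Lambda>\<^sub>i\<close>.

  For necessity, a train of \<open>k\<close> rectangular bumps of width \<open>1 / (2n)\<close>, period \<open>1 / n\<close> and height
  \<open>S\<^sub>k powr (- 1 / p)\<close> has variation bounded by a constant, whereas a translation by half a period changes it by
  its full height on a set of measure at least \<open>k / (2n)\<close>; optimising over \<open>k \<le> n\<close>, its integral modulus at \<open>1 / n\<close> is at
  least a constant times \<open>n powr (- 1 / q) W\<^sub>n\<close>. If the criterion fails, infinitely many such trains, scaled
  by \<open>1 / 2 ^ l\<close> and belonging to rapidly worse values of \<open>n\<close>, are placed into disjoint dyadic intervals. Restricting \<open>k\<close>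
  so that the \<open>l\<close>-th train fits costs only a power of \<open>2\<^sup>l\<close>, which a sufficiently large excess in the criterion
  compensates. For disjoint supports the variations add up (\<open>endpoint_variation_bound_glue\<close>), and each train is seen
  undisturbed by the integral modulus, so that the resulting function lies in the Waterman-Shiba class but not in
  the class determined by \<open>\<omega>\<close>.
\<close>

section \<open>Decreasing finite sequences with a bounded weighted sum\<close>

text \<open>
  Abel summation: replacing the weight \<^term>\<open>x i\<close> of each earlier term by the smallest weight seen so
  far can only lower the sum, so the sum stays above \<^term>\<open>x n\<close> times the last partial sum.
\<close>

lemma weighted_sum_nonneg_if_partial_sums_nonneg:
  fixes x d :: "nat \<Rightarrow> real"
  assumes dec: "\<And>i j. 1 \<le> i \<Longrightarrow> i \<le> j \<Longrightarrow> j \<le> n \<Longrightarrow> x j \<le> x i"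
    and nonneg: "\<And>i. 1 \<le> i \<Longrightarrow> i \<le> n \<Longrightarrow> 0 \<le> x i"
    and partial: "\<And>k. 1 \<le> k \<Longrightarrow> k \<le> n \<Longrightarrow> 0 \<le> (\<Sum>i=1..k. d i)"
  shows "0 \<le> (\<Sum>i=1..n. x i * d i)"
proof (cases "n = 0")
  case False
  \<comment> \<open>The stronger claim that carries the induction.\<close>
  have "x k * (\<Sum>i=1..k. d i) \<le> (\<Sum>i=1..k. x i * d i)" if "1 \<le> k" "k \<le> n" for k
    using that
  proof (induction k rule: nat_induct_at_least)
    case (Suc k)
    have "x (Suc k) * (\<Sum>i=1..Suc k. d i) = x (Suc k) * (\<Sum>i=1..k. d i) + x (Suc k) * d (Suc k)"
      by (simp add: algebra_simps)
    also have "\<dots> \<le> x k * (\<Sum>i=1..k. d i) + x (Suc k) * d (Suc k)"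
      using Suc.hyps Suc.prems by (intro add_right_mono mult_right_mono dec partial) auto
    also have "\<dots> \<le> (\<Sum>i=1..k. x i * d i) + x (Suc k) * d (Suc k)"
      using Suc by simp
    finally show ?case by simp
  qed simp
  from this[of n] False nonneg[of n] partial[of n] show ?thesis
    by (smt (verit, best) One_nat_def Suc_leI le_refl mult_nonneg_nonneg not_gr0)
qed simp

text \<open>
  Convexity on the closed half-line: the end point 0 has to be added by hand to the convexity on
  the positive reals, because sequences with vanishing entries occur below.
\<close>

lemma convex_on_powr_nonneg:
  fixes r :: real
  assumes "1 \<le> r"
  shows "convex_on {0..} (\<lambda>x. x powr r)"
proof (rule convex_onI)
  fix t x y :: real
  assume t: "0 < t" "t < 1" and xy: "x \<in> {0..}" "y \<in> {0..}"
  have scale: "(s * z) powr r \<le> s * z powr r" if "0 < s" "s < 1" "0 \<le> z" for s z :: real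
  proof -
    have "s powr r \<le> s powr 1"
      using that assms by (intro powr_mono') auto
    then show ?thesis
      using that by (simp add: powr_mult mult_right_mono)
  qed
  consider "x = 0" | "y = 0" | "0 < x" "0 < y"
    using xy by fastforce
  then show "((1 - t) *\<^sub>R x + t *\<^sub>R y) powr r \<le> (1 - t) * x powr r + t * y powr r"
  proof cases
    case 1
    then show ?thesis using scale[of t y] t xy assms by simp
  next
    case 2
    then show ?thesis using scale[of "1 - t" x] t xy assms by simp
  next
    case 3
    then show ?thesis
      using convex_onD[OF powr_convex[OF assms], of t x y] t by simp
  qed
qed auto

text \<open>
  Both \<^term>\<open>s + h\<close> and \<^term>\<open>t\<close> are convex combinations of the outer points \<^term>\<open>s\<close> and \<^term>\<open>t + h\<close>, with
  complementary coefficients; adding the two convexity inequalities gives the claim.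
\<close>

lemma powr_increment_mono:
  fixes r s t h :: real
  assumes "1 \<le> r" "0 \<le> s" "s \<le> t" "0 \<le> h"
  shows "(s + h) powr r - s powr r \<le> (t + h) powr r - t powr r"
proof (cases "s = t + h")
  case False
  then have pos: "t + h - s > 0" using assms by simp
  define l where "l = h / (t + h - s)"
  have l: "0 \<le> l" "l \<le> 1" using pos assms by (auto simp: l_def field_simps)
  have lh: "l * (t + h - s) = h" using pos by (simp add: l_def)
  have e1: "(1 - l) * s + l * (t + h) = s + h" using lh by (simp add: algebra_simps)
  have e2: "(1 - (1 - l)) * s + (1 - l) * (t + h) = t" using lh by (simp add: algebra_simps)
  note conv = convex_onD[OF convex_on_powr_nonneg[OF assms(1)]]
  have "(s + h) powr r \<le> (1 - l) * s powr r + l * (t + h) powr r"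
    using conv[of l s "t + h"] l assms e1 by simp
  moreover have "t powr r \<le> l * s powr r + (1 - l) * (t + h) powr r"
    using conv[of "1 - l" s "t + h"] l assms e2 by simp
  ultimately show ?thesis by (simp add: algebra_simps)
qed (use assms in auto)

text \<open>
  The \<open>\<ell>\<^sup>r\<close> norm of a decreasing sequence is at most its Lorentz \<open>\<ell>(r,1)\<close> norm. The weights are chosen
  so that equality holds for constant sequences. In the induction, the new entry increases the
  right-hand side least when all earlier entries are as small as monotonicity permits, that is,
  equal to the new one, and then the increase is exactly \<open>x\<^sup>r\<close>.
\<close>

lemma sum_powr_le_powr_lorentz_sum:
  fixes x :: "nat \<Rightarrow> real"
  assumes r: "1 \<le> r"
    and dec: "\<And>i j. 1 \<le> i \<Longrightarrow> i \<le> j \<Longrightarrow> j \<le> n \<Longrightarrow> x j \<le> x i"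
    and nonneg: "\<And>i. 1 \<le> i \<Longrightarrow> i \<le> n \<Longrightarrow> 0 \<le> x i"
  shows "(\<Sum>i=1..n. x i powr r)
           \<le> (\<Sum>i=1..n. x i * (real i powr (1 / r) - real (i - 1) powr (1 / r))) powr r"
proof -
  define \<nu> where "\<nu> i = real i powr (1 / r) - real (i - 1) powr (1 / r)" for i :: nat
  define T where "T k = (\<Sum>i=1..k. x i * \<nu> i)" for k
  have \<nu>0: "0 \<le> \<nu> i" for i unfolding \<nu>_def using r by (simp add: powr_mono2)
  have \<nu>sum: "(\<Sum>i=1..k. \<nu> i) = real k powr (1 / r)" for k
    by (induction k) (use r in \<open>auto simp: \<nu>_def\<close>)
  have "(\<Sum>i=1..k. x i powr r) \<le> T k powr r" if "k \<le> n" for k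
    using that
  proof (induction k)
    case (Suc k)
    \<comment> \<open>The value of \<^term>\<open>T k\<close> if the first \<^term>\<open>k\<close> entries were all equal to the new one.\<close>
    define s where "s = real k powr (1 / r) * x (Suc k)"
    have x0: "0 \<le> x (Suc k)" using Suc.prems by (intro nonneg) auto
    have "(\<Sum>i=1..k. x (Suc k) * \<nu> i) \<le> T k"
      unfolding T_def using Suc.prems by (intro sum_mono mult_right_mono dec \<nu>0) auto
    then have "s \<le> T k"
      by (simp add: s_def \<nu>sum mult.commute[of _ "x (Suc k)"] del: One_nat_def flip: sum_distrib_left)
    moreover have "0 \<le> x (Suc k) * \<nu> (Suc k)" "0 \<le> s" using x0 \<nu>0 by (auto simp: s_def)
    ultimately have "(s + x (Suc k) * \<nu> (Suc k)) powr r - s powr r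
        \<le> (T k + x (Suc k) * \<nu> (Suc k)) powr r - T k powr r"
      using r by (intro powr_increment_mono) auto
    moreover have "(s + x (Suc k) * \<nu> (Suc k)) powr r - s powr r = x (Suc k) powr r"
    proof -
      have scaled: "(real j powr (1 / r) * x (Suc k)) powr r = real j * x (Suc k) powr r" for j
        using r x0 by (simp add: powr_mult powr_powr)
      have "s + x (Suc k) * \<nu> (Suc k) = real (Suc k) powr (1 / r) * x (Suc k)"
        by (simp add: s_def \<nu>_def algebra_simps)
      then show ?thesis
        unfolding s_def by (simp only: scaled) (simp add: algebra_simps)
    qed
    moreover have "T (Suc k) = T k + x (Suc k) * \<nu> (Suc k)" by (simp add: T_def)
    ultimately have "x (Suc k) powr r \<le> T (Suc k) powr r - T k powr r" by simp
    then show ?case using Suc by simp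
  qed (simp add: T_def)
  then show ?thesis by (simp add: T_def \<nu>_def)
qed

lemma prefix_average_antimono:
  fixes \<mu> :: "nat \<Rightarrow> real"
  assumes dec: "\<And>i j. 1 \<le> i \<Longrightarrow> i \<le> j \<Longrightarrow> \<mu> j \<le> \<mu> i" and "k \<le> n"
  shows "real k * (\<Sum>i=1..n. \<mu> i) \<le> real n * (\<Sum>i=1..k. \<mu> i)"
  using \<open>k \<le> n\<close>
proof (induction n rule: dec_induct)
  case (step n)
  have "(\<Sum>i=1..k. \<mu> (Suc n)) \<le> (\<Sum>i=1..k. \<mu> i)"
    using step by (intro sum_mono dec) auto
  then show ?case using step by (simp add: algebra_simps)
qed simp

text \<open>
  The extremal problem behind the theorem: maximise \<open>\<Sum> y\<^sub>i\<^sup>r\<close> over decreasing sequences with a bounded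
  weighted sum. For \<open>r \<ge> 1\<close> the objective is convex and the maximum sits at a sequence that is constant
  on an initial segment, which is why only the numbers \<open>k / S\<^sub>k\<^sup>r\<close> matter (\<open>S\<^sub>k\<close> is the sum of the first
  \<open>k\<close> weights); this is obtained by comparing the weights with the Lorentz weights through Abel
  summation. For \<open>r < 1\<close> the objective is concave, and averaging the whole sequence can only help:
  Chebyshev bounds the average of \<open>y\<close>, and Jensen passes to powers.
\<close>

lemma sum_powr_le_of_decreasing_weighted_sum:
  fixes y \<mu> :: "nat \<Rightarrow> real" and K M r :: real
  assumes r: "0 < r" and n: "1 \<le> n"
    and dec: "\<And>i j. 1 \<le> i \<Longrightarrow> i \<le> j \<Longrightarrow> j \<le> n \<Longrightarrow> y j \<le> y i"
    and nonneg: "\<And>i. 1 \<le> i \<Longrightarrow> i \<le> n \<Longrightarrow> 0 \<le> y i"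
    and \<mu>dec: "\<And>i j. 1 \<le> i \<Longrightarrow> i \<le> j \<Longrightarrow> \<mu> j \<le> \<mu> i"
    and \<mu>pos: "\<And>i. 1 \<le> i \<Longrightarrow> 0 < \<mu> i"
    and K: "(\<Sum>i=1..n. y i * \<mu> i) \<le> K"
    and M: "\<And>k. 1 \<le> k \<Longrightarrow> k \<le> n \<Longrightarrow> real k / (\<Sum>i=1..k. \<mu> i) powr r \<le> M"
  shows "(\<Sum>i=1..n. y i powr r) \<le> K powr r * M"
proof -
  define S where "S k = (\<Sum>i=1..k. \<mu> i)" for k
  have Spos: "0 < S k" if "1 \<le> k" for k
    unfolding S_def using that \<mu>pos by (intro sum_pos) auto
  have "0 \<le> real 1 / S 1 powr r" by simp
  also have "\<dots> \<le> M" using M[of 1] n by (simp add: S_def)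
  finally have M0: "0 \<le> M" .
  have sum0: "0 \<le> (\<Sum>i=1..n. y i * \<mu> i)"
    using nonneg \<mu>pos by (intro sum_nonneg mult_nonneg_nonneg) (auto intro: less_imp_le)
  then have K0: "0 \<le> K" using K by simp
  show ?thesis
  proof (cases "1 \<le> r")
    case True
    \<comment> \<open>With this constant, \<open>k powr (1 / r) \<le> B S\<^sub>k\<close> is the hypothesis on \<^term>\<open>M\<close>,
      so the partial sums of \<open>B \<mu>\<close> dominate those of the Lorentz weights.\<close>
    define B where "B = M powr (1 / r)"
    define \<nu> where "\<nu> i = real i powr (1 / r) - real (i - 1) powr (1 / r)" for i :: nat
    have \<nu>0: "0 \<le> \<nu> i" for i unfolding \<nu>_def using r by (simp add: powr_mono2)
    have \<nu>sum: "(\<Sum>i=1..k. \<nu> i) = real k powr (1 / r)" for k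
      by (induction k) (use r in \<open>auto simp: \<nu>_def\<close>)
    have "0 \<le> (\<Sum>i=1..n. y i * (B * \<mu> i - \<nu> i))"
    proof (rule weighted_sum_nonneg_if_partial_sums_nonneg)
      fix k assume k: "1 \<le> k" "k \<le> n"
      have "real k \<le> M * S k powr r"
        using M[OF k] Spos[OF k(1)] by (simp add: S_def divide_le_eq)
      then have "real k powr (1 / r) \<le> (M * S k powr r) powr (1 / r)"
        using r by (intro powr_mono2) auto
      also have "\<dots> = B * S k"
        using r M0 Spos[OF k(1)] by (simp add: B_def powr_mult powr_powr)
      finally show "0 \<le> (\<Sum>i=1..k. B * \<mu> i - \<nu> i)"
        by (simp add: sum_subtractf \<nu>sum S_def del: One_nat_def flip: sum_distrib_left)
    qed (use dec nonneg in auto)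
    then have "(\<Sum>i=1..n. y i * \<nu> i) \<le> B * (\<Sum>i=1..n. y i * \<mu> i)"
      by (simp add: algebra_simps sum_subtractf sum_distrib_left)
    also have "\<dots> \<le> B * K" using K by (simp add: B_def mult_left_mono)
    finally have le: "(\<Sum>i=1..n. y i * \<nu> i) \<le> B * K" .
    have "(\<Sum>i=1..n. y i powr r) \<le> (\<Sum>i=1..n. y i * \<nu> i) powr r"
      unfolding \<nu>_def by (intro sum_powr_le_powr_lorentz_sum True dec nonneg)
    also have "\<dots> \<le> (B * K) powr r"
      using le r nonneg \<nu>0 by (intro powr_mono2 sum_nonneg mult_nonneg_nonneg) auto
    also have "\<dots> = K powr r * M"
      using r M0 K0 by (simp add: B_def powr_mult powr_powr)
    finally show ?thesis .
  next
    case False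
    \<comment> \<open>Chebyshev: the weights are compared with their average.\<close>
    have "0 \<le> (\<Sum>i=1..n. y i * (\<mu> i - S n / real n))"
    proof (rule weighted_sum_nonneg_if_partial_sums_nonneg)
      fix k assume k: "1 \<le> k" "k \<le> n"
      then have "real k * (S n / real n) \<le> S k"
        using prefix_average_antimono[of \<mu> k n] \<mu>dec n by (simp add: S_def field_simps)
      then show "0 \<le> (\<Sum>i=1..k. \<mu> i - S n / real n)"
        by (simp add: sum_subtractf S_def)
    qed (use dec nonneg in auto)
    then have "(S n / real n) * (\<Sum>i=1..n. y i) \<le> (\<Sum>i=1..n. y i * \<mu> i)"
      by (simp add: algebra_simps sum_subtractf sum_distrib_left)
    also note K
    finally have mean: "(\<Sum>i=1..n. y i) / real n \<le> K / S n"
      using n Spos[OF n] by (simp add: field_simps)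
    \<comment> \<open>Jensen is applied to the powers, since \<open>1 / r \<ge> 1\<close> makes the inverse power convex.\<close>
    define u where "u i = y i powr r" for i
    have "((\<Sum>i=1..n. (1 / real n) *\<^sub>R u i)) powr (1 / r) \<le> (\<Sum>i=1..n. (1 / real n) * u i powr (1 / r))"
      by (rule convex_on_sum[OF _ _ convex_on_powr_nonneg])
         (use n False r in \<open>auto simp: u_def\<close>)
    also have "\<dots> = (\<Sum>i=1..n. y i) / real n"
      using nonneg r by (simp add: u_def powr_powr sum_divide_distrib)
    also note mean
    finally have "((\<Sum>i=1..n. u i) / real n) powr (1 / r) \<le> K / S n"
      by (simp add: sum_divide_distrib)
    then have "(((\<Sum>i=1..n. u i) / real n) powr (1 / r)) powr r \<le> (K / S n) powr r"
      using r by (intro powr_mono2) auto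
    moreover have "0 \<le> (\<Sum>i=1..n. u i)" by (simp add: u_def sum_nonneg)
    ultimately have "(\<Sum>i=1..n. u i) / real n \<le> (K / S n) powr r"
      using r by (simp add: powr_powr)
    then have "(\<Sum>i=1..n. u i) \<le> K powr r * (real n / S n powr r)"
      using n K0 Spos[OF n] by (simp add: powr_divide field_simps)
    also have "\<dots> \<le> K powr r * M"
      using M[OF n] by (intro mult_left_mono) (auto simp: S_def)
    finally show ?thesis by (simp add: u_def)
  qed
qed

section \<open>Waterman-Shiba functions through endpoints\<close>

text \<open>
  The variation of \<^term>\<open>f\<close> only depends on the end points of the intervals. An arbitrary index set
  makes it possible to produce a family first and to order it afterwards.
\<close>

definition nonoverlapping_endpoints :: "'a set \<Rightarrow> ('a \<Rightarrow> real) \<Rightarrow> ('a \<Rightarrow> real) \<Rightarrow> bool" where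
  "nonoverlapping_endpoints A a b \<longleftrightarrow>
     (\<forall>i\<in>A. 0 \<le> a i \<and> a i \<le> b i \<and> b i \<le> 1) \<and> disjoint_family_on (\<lambda>i. {a i<..<b i}) A"

definition endpoint_variation_bound :: "(nat \<Rightarrow> real) \<Rightarrow> real \<Rightarrow> (real \<Rightarrow> real) \<Rightarrow> real \<Rightarrow> bool" where
  "endpoint_variation_bound \<Lambda> p f K \<longleftrightarrow>
     (\<forall>n a b. nonoverlapping_endpoints {1..n} a b \<longrightarrow>
        (\<Sum>i=1..n. \<bar>f (b i) - f (a i)\<bar> powr p / \<Lambda> i) \<le> K)"

lemma nonoverlapping_family_of_endpoints:
  assumes "nonoverlapping_endpoints {1..n} a b"
  shows "nonoverlapping_family n (\<lambda>i. {a i..b i})"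
  using assms
  by (auto simp: nonoverlapping_family_def nonoverlapping_endpoints_def is_interval_cc
      disjoint_family_on_def)

lemma endpoints_of_nonoverlapping_family:
  assumes "nonoverlapping_family n I"
  shows "nonoverlapping_endpoints {1..n} (\<lambda>i. Inf (I i)) (\<lambda>i. Sup (I i))"
proof -
  have sub: "0 \<le> Inf (I i) \<and> Inf (I i) \<le> Sup (I i) \<and> Sup (I i) \<le> 1"
    and int: "{Inf (I i)<..<Sup (I i)} \<subseteq> interior (I i)" if "i \<in> {1..n}" for i
  proof -
    have I: "is_interval (I i)" "I i \<noteq> {}" "I i \<subseteq> {0..1}"
      using assms that by (auto simp: nonoverlapping_family_def)
    have bdd: "bdd_above (I i)" "bdd_below (I i)"
      using I(3) by (meson bdd_above_Icc bdd_above_mono bdd_below_Icc bdd_below_mono)+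
    show "0 \<le> Inf (I i) \<and> Inf (I i) \<le> Sup (I i) \<and> Sup (I i) \<le> 1"
      using I bdd by (intro conjI cInf_greatest cSup_least cInf_le_cSup) auto
    \<comment> \<open>The gap between the end points belongs to the interior, so disjoint interiors
      give disjoint gaps.\<close>
    have "{Inf (I i)<..<Sup (I i)} \<subseteq> I i"
    proof
      fix x assume x: "x \<in> {Inf (I i)<..<Sup (I i)}"
      obtain u where "u \<in> I i" "u < x"
        using x I(2) bdd by (auto simp: cInf_less_iff)
      moreover obtain v where "v \<in> I i" "x < v"
        using x I(2) bdd by (auto simp: less_cSup_iff)
      ultimately show "x \<in> I i"
        using I(1) by (meson is_interval_1 less_imp_le)
    qed
    then show "{Inf (I i)<..<Sup (I i)} \<subseteq> interior (I i)"
      by (simp add: interior_maximal)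
  qed
  show ?thesis
    using assms sub int unfolding nonoverlapping_endpoints_def nonoverlapping_family_def
      disjoint_family_on_def by blast
qed

lemma Waterman_Shiba_iff_endpoint_variation:
  assumes p: "1 \<le> p" and pos: "\<And>i. 1 \<le> i \<Longrightarrow> 0 < \<Lambda> i"
  shows "f \<in> Waterman_Shiba \<Lambda> p \<longleftrightarrow> (\<exists>K. endpoint_variation_bound \<Lambda> p f K)"
proof
  define V where "V n I = (\<Sum>i=1..n. \<bar>increment f (I i)\<bar> powr p / \<Lambda> i)" for n I
  have V0: "0 \<le> V n I" for n I
    unfolding V_def using pos by (intro sum_nonneg divide_nonneg_pos) auto
  {
    assume "f \<in> Waterman_Shiba \<Lambda> p"
    then have fin: "WS_variation \<Lambda> p f < \<infinity>" by (simp add: Waterman_Shiba_def)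
    have upper: "ereal (V n I powr (1 / p)) \<le> WS_variation \<Lambda> p f" if "nonoverlapping_family n I" for n I
      unfolding WS_variation_def V_def using that by (intro SUP_upper2[of "(n, I)"]) auto
    \<comment> \<open>The empty family shows that the variation is not \<open>-\<infinity>\<close>.\<close>
    have "nonoverlapping_family 0 (\<lambda>_. {})"
      by (simp add: nonoverlapping_family_def disjoint_family_on_def)
    from upper[OF this] have "0 \<le> WS_variation \<Lambda> p f" by (simp add: V_def zero_ereal_def)
    with fin obtain c where c: "WS_variation \<Lambda> p f = ereal c"
      by (cases "WS_variation \<Lambda> p f") auto
    have "(\<Sum>i=1..n. \<bar>f (b i) - f (a i)\<bar> powr p / \<Lambda> i) \<le> c powr p"
      if ab: "nonoverlapping_endpoints {1..n} a b" for n a b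
    proof -
      let ?I = "\<lambda>i. {a i..b i}"
      have "V n ?I powr (1 / p) \<le> c"
        using upper[OF nonoverlapping_family_of_endpoints[OF ab]] c by simp
      then have "(V n ?I powr (1 / p)) powr p \<le> c powr p"
        using p by (intro powr_mono2) auto
      then have "V n ?I \<le> c powr p" using p V0 by (simp add: powr_powr)
      moreover have "V n ?I = (\<Sum>i=1..n. \<bar>f (b i) - f (a i)\<bar> powr p / \<Lambda> i)"
        unfolding V_def using ab
        by (intro sum.cong) (auto simp: increment_def nonoverlapping_endpoints_def)
      ultimately show ?thesis by simp
    qed
    then show "\<exists>K. endpoint_variation_bound \<Lambda> p f K"
      unfolding endpoint_variation_bound_def by blast
  next
    assume "\<exists>K. endpoint_variation_bound \<Lambda> p f K"
    then obtain K where K: "endpoint_variation_bound \<Lambda> p f K" ..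
    have "WS_variation \<Lambda> p f \<le> ereal (K powr (1 / p))"
      unfolding WS_variation_def
    proof (rule SUP_least, clarsimp)
      fix n I assume "nonoverlapping_family n I"
      from K endpoints_of_nonoverlapping_family[OF this]
      have "V n I \<le> K"
        unfolding endpoint_variation_bound_def V_def increment_def by blast
      then have "V n I powr (1 / p) \<le> K powr (1 / p)"
        using V0 p by (intro powr_mono2) auto
      then show "(\<Sum>i = Suc 0..n. \<bar>increment f (I i)\<bar> powr p / \<Lambda> i) powr (1 / p) \<le> K powr (1 / p)"
        by (simp add: V_def)
    qed
    then show "f \<in> Waterman_Shiba \<Lambda> p" by (auto simp: Waterman_Shiba_def)
  }
qed

lemma endpoint_variation_bound_reindexed:
  assumes "endpoint_variation_bound \<Lambda> p f K" "nonoverlapping_endpoints A a b"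
    and "bij_betw \<rho> {1..n} A"
  shows "(\<Sum>i=1..n. \<bar>f (b (\<rho> i)) - f (a (\<rho> i))\<bar> powr p / \<Lambda> i) \<le> K"
proof -
  have inj: "inj_on \<rho> {1..n}" and im: "\<rho> ` {1..n} = A"
    using assms(3) by (auto simp: bij_betw_def)
  have "nonoverlapping_endpoints {1..n} (a \<circ> \<rho>) (b \<circ> \<rho>)"
    unfolding nonoverlapping_endpoints_def
  proof
    show "\<forall>i\<in>{1..n}. 0 \<le> (a \<circ> \<rho>) i \<and> (a \<circ> \<rho>) i \<le> (b \<circ> \<rho>) i \<and> (b \<circ> \<rho>) i \<le> 1"
      using assms(2) im unfolding nonoverlapping_endpoints_def comp_def by blast
    show "disjoint_family_on (\<lambda>i. {(a \<circ> \<rho>) i<..<(b \<circ> \<rho>) i}) {1..n}"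
      unfolding disjoint_family_on_def comp_def
    proof (intro ballI impI)
      fix i j assume "i \<in> {1..n}" "j \<in> {1..n}" "i \<noteq> j"
      moreover from this have "\<rho> i \<noteq> \<rho> j" using inj by (auto dest: inj_onD)
      ultimately show "{a (\<rho> i)<..<b (\<rho> i)} \<inter> {a (\<rho> j)<..<b (\<rho> j)} = {}"
        using assms(2) im unfolding nonoverlapping_endpoints_def disjoint_family_on_def by blast
    qed
  qed
  from assms(1)[unfolded endpoint_variation_bound_def, rule_format, OF this]
  show ?thesis by (simp add: comp_def)
qed

text \<open>
  Since all orderings of a family compete in the variation, the increments may be listed in
  decreasing order; this is where the extremal problem for decreasing sequences comes from.
\<close>

lemma ex_decreasing_enumeration:
  fixes x :: "'a \<Rightarrow> real"
  assumes "finite A"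
  shows "\<exists>\<rho>. bij_betw \<rho> {1..card A} A \<and>
           (\<forall>i j. 1 \<le> i \<longrightarrow> i \<le> j \<longrightarrow> j \<le> card A \<longrightarrow> x (\<rho> j) \<le> x (\<rho> i))"
proof -
  obtain ys where ys: "set ys = A" "distinct ys"
    using finite_distinct_list[OF assms] by blast
  define xs where "xs = sort_key (\<lambda>i. - x i) ys"
  have xs: "set xs = A" "distinct xs" "length xs = card A" "sorted (map (\<lambda>i. - x i) xs)"
    using ys by (auto simp: xs_def distinct_card)
  have "bij_betw (\<lambda>i. i - 1) {1..card A} {..<card A}"
    by (rule bij_betw_byWitness[where f' = Suc]) auto
  moreover have "bij_betw ((!) xs) {..<card A} A"
    using xs by (intro bij_betw_nth) auto
  ultimately have "bij_betw ((!) xs \<circ> (\<lambda>i. i - 1)) {1..card A} A"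
    by (rule bij_betw_trans)
  moreover have "x (xs ! (j - 1)) \<le> x (xs ! (i - 1))" if "1 \<le> i" "i \<le> j" "j \<le> card A" for i j
    using sorted_nth_mono[OF xs(4), of "i - 1" "j - 1"] that xs(3) by simp
  ultimately show ?thesis by (auto simp: comp_def)
qed

section \<open>Boundedness and measurability\<close>

lemma bounded_if_endpoint_variation_bound:
  assumes p: "1 \<le> p" and pos: "0 < \<Lambda> 1" and K: "endpoint_variation_bound \<Lambda> p f K"
  shows "\<exists>B. \<forall>x\<in>{0..1}. \<bar>f x\<bar> \<le> B"
proof (intro exI ballI)
  fix x :: real assume x: "x \<in> {0..1}"
  have "nonoverlapping_endpoints {1..1::nat} (\<lambda>_. 0) (\<lambda>_. x)"
    using x by (simp add: nonoverlapping_endpoints_def disjoint_family_on_def)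
  from K[unfolded endpoint_variation_bound_def, rule_format, OF this]
  have "\<bar>f x - f 0\<bar> powr p \<le> K * \<Lambda> 1"
    using pos by (simp add: field_simps)
  then have "(\<bar>f x - f 0\<bar> powr p) powr (1 / p) \<le> (K * \<Lambda> 1) powr (1 / p)"
    using p by (intro powr_mono2) auto
  then have "\<bar>f x - f 0\<bar> \<le> (K * \<Lambda> 1) powr (1 / p)" using p by (simp add: powr_powr)
  then show "\<bar>f x\<bar> \<le> \<bar>f 0\<bar> + (K * \<Lambda> 1) powr (1 / p)" by linarith
qed

text \<open>
  At \<open>n\<close> points where \<^term>\<open>f\<close> is discontinuous with oscillation at least \<open>e\<close> one can attach disjoint small intervals
  with increments at least \<open>e\<close>. Their contribution \<open>e\<^sup>p (1 / \<Lambda>\<^sub>1 + \<dots> + 1 / \<Lambda>\<^sub>n)\<close> is bounded, whereas the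
  series of the \<open>1 / \<Lambda>\<^sub>i\<close> diverges.
\<close>

lemma finite_large_oscillation:
  assumes pos: "\<And>i. 1 \<le> i \<Longrightarrow> 0 < \<Lambda> i"
    and div: "filterlim (\<lambda>n. \<Sum>i=1..n. 1 / \<Lambda> i) at_top sequentially"
    and p: "1 \<le> p" and K: "endpoint_variation_bound \<Lambda> p f K" and e: "0 < e"
  shows "finite {x\<in>{0<..<1}. \<forall>d>0. \<exists>y. \<bar>y - x\<bar> < d \<and> e \<le> \<bar>f y - f x\<bar>}" (is "finite ?D")
proof (rule ccontr)
  assume inf: "infinite ?D"
  have "eventually (\<lambda>n. K / e powr p < (\<Sum>i=1..n. 1 / \<Lambda> i)) sequentially"
    using div by (simp add: filterlim_at_top_dense)
  then obtain n where n: "K / e powr p < (\<Sum>i=1..n. 1 / \<Lambda> i)"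
    by (auto simp: eventually_sequentially)
  obtain X where X: "X \<subseteq> ?D" "finite X" "card X = n"
    using infinite_arbitrarily_large[OF inf] by blast
  have ev: "eventually (\<lambda>d. d \<le> c) (at_right 0)" if "0 < c" for c :: real
    using eventually_at_right_less[of 0] that
    by (metis (mono_tags, lifting) eventually_at_right_field less_imp_le)
  have "eventually (\<lambda>d. \<forall>x\<in>X. d \<le> x \<and> d \<le> 1 - x \<and> (\<forall>y\<in>X. x \<noteq> y \<longrightarrow> d \<le> \<bar>x - y\<bar> / 2)) (at_right 0)"
  proof (intro eventually_ball_finite X(2) ballI eventually_conj)
    fix x y assume "x \<in> X" "y \<in> X"
    then show "eventually (\<lambda>d. d \<le> x) (at_right 0)" "eventually (\<lambda>d. d \<le> 1 - x) (at_right 0)"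
      "eventually (\<lambda>d. x \<noteq> y \<longrightarrow> d \<le> \<bar>x - y\<bar> / 2) (at_right 0)"
      using X(1) by (auto intro!: ev) (cases "x = y"; use ev[of "\<bar>x - y\<bar> / 2"] in simp)
  qed
  moreover have "eventually (\<lambda>d. 0 < (d::real)) (at_right 0)"
    by (rule eventually_at_right_less)
  ultimately have "eventually (\<lambda>d. 0 < d \<and> (\<forall>x\<in>X. d \<le> x \<and> d \<le> 1 - x \<and> (\<forall>y\<in>X. x \<noteq> y \<longrightarrow> d \<le> \<bar>x - y\<bar> / 2))) (at_right 0)"
    by eventually_elim auto
  then obtain d where d: "0 < d" "\<And>x. x \<in> X \<Longrightarrow> d \<le> x \<and> d \<le> 1 - x"
    "\<And>x y. x \<in> X \<Longrightarrow> y \<in> X \<Longrightarrow> x \<noteq> y \<Longrightarrow> d \<le> \<bar>x - y\<bar> / 2"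
    using eventually_happens'[OF trivial_limit_at_right_real] by blast
  have "\<forall>x\<in>X. \<exists>y. \<bar>y - x\<bar> < d \<and> e \<le> \<bar>f y - f x\<bar>" using X(1) d(1) by blast
  then obtain y where y: "\<And>x. x \<in> X \<Longrightarrow> \<bar>y x - x\<bar> < d \<and> e \<le> \<bar>f (y x) - f x\<bar>" by metis
  have ends: "nonoverlapping_endpoints X (\<lambda>x. min x (y x)) (\<lambda>x. max x (y x))"
    unfolding nonoverlapping_endpoints_def
  proof (intro conjI ballI)
    show "disjoint_family_on (\<lambda>x. {min x (y x)<..<max x (y x)}) X"
      unfolding disjoint_family_on_def
    proof (intro ballI impI)
      fix u v assume uv: "u \<in> X" "v \<in> X" "u \<noteq> v"
      have "\<bar>z - w\<bar> < d" if "w \<in> X" "z \<in> {min w (y w)<..<max w (y w)}" for w z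
        using y[OF that(1)] that(2) by (auto simp: min_def max_def split: if_splits)
      note near = this
      show "{min u (y u)<..<max u (y u)} \<inter> {min v (y v)<..<max v (y v)} = {}"
      proof (rule equals0I)
        fix z assume "z \<in> {min u (y u)<..<max u (y u)} \<inter> {min v (y v)<..<max v (y v)}"
        then have "\<bar>z - u\<bar> < d" "\<bar>z - v\<bar> < d" using near uv by blast+
        with d(3)[OF uv] show False by (smt (verit) field_sum_of_halves)
      qed
    qed
  next
    fix x assume x: "x \<in> X"
    show "0 \<le> min x (y x)" "min x (y x) \<le> max x (y x)" "max x (y x) \<le> 1"
      using y[OF x] d(2)[OF x] d(1) by auto
  qed
  obtain \<rho> where \<rho>: "bij_betw \<rho> {1..n} X"
    using ex_decreasing_enumeration[OF X(2)] X(3) by blast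
  have "e powr p * (\<Sum>i=1..n. 1 / \<Lambda> i) = (\<Sum>i=1..n. e powr p / \<Lambda> i)"
    by (simp add: sum_distrib_left)
  also have "\<dots> \<le> (\<Sum>i=1..n. \<bar>f (max (\<rho> i) (y (\<rho> i))) - f (min (\<rho> i) (y (\<rho> i)))\<bar> powr p / \<Lambda> i)"
  proof (intro sum_mono divide_right_mono)
    fix i assume i: "i \<in> {1..n}"
    then show "0 \<le> \<Lambda> i" using pos[of i] by auto
    have "\<rho> i \<in> X" using \<rho> i by (auto dest: bij_betwE)
    from y[OF this] show "e powr p \<le> \<bar>f (max (\<rho> i) (y (\<rho> i))) - f (min (\<rho> i) (y (\<rho> i)))\<bar> powr p"
      using e p by (intro powr_mono2) (auto simp: min_def max_def abs_minus_commute)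
  qed
  also have "\<dots> \<le> K" by (rule endpoint_variation_bound_reindexed[OF K ends \<rho>])
  finally show False using n e by (simp add: field_simps)
qed

text \<open>
  Extending \<^term>\<open>f\<close> by its boundary values turns translated grids that leave the unit interval into
  grids inside it, with vanishing increments outside.
\<close>

definition clamped :: "(real \<Rightarrow> real) \<Rightarrow> real \<Rightarrow> real" where
  "clamped f x = f (max 0 (min 1 x))"

lemma clamped_eq [simp]: "x \<in> {0..1} \<Longrightarrow> clamped f x = f x"
  by (simp add: clamped_def)

text \<open>
  Waterman-Shiba functions have at most countably many discontinuities: each one has oscillation
  at least \<open>1 / m\<close> for some \<open>m\<close>.
\<close>

lemma borel_measurable_clamped:
  assumes pos: "\<And>i. 1 \<le> i \<Longrightarrow> 0 < \<Lambda> i"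
    and div: "filterlim (\<lambda>n. \<Sum>i=1..n. 1 / \<Lambda> i) at_top sequentially"
    and p: "1 \<le> p" and K: "endpoint_variation_bound \<Lambda> p f K"
  shows "clamped f \<in> borel_measurable borel"
proof -
  define D where "D e = {x\<in>{0<..<1}. \<forall>d>0. \<exists>y. \<bar>y - x\<bar> < d \<and> e \<le> \<bar>f y - f x\<bar>}" for e
  define X where "X = {0, 1} \<union> (\<Union>m. D (1 / real (Suc m)))"
  have "countable (D e)" if "0 < e" for e
    unfolding D_def by (intro countable_finite finite_large_oscillation[OF pos div p K] that)
  then have "countable X"
    unfolding X_def by (intro countable_Un countable_UN) auto
  moreover have "continuous_on (- X) (clamped f)"
  proof (rule continuous_at_imp_continuous_on, rule ballI)
    fix x assume "x \<in> - X"
    then consider "x < 0" | "1 < x" | "0 < x" "x < 1" "\<And>m. x \<notin> D (1 / real (Suc m))"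
      by (fastforce simp: X_def)
    then show "isCont (clamped f) x"
    proof cases
      case 1
      have "continuous_on {..<0} (clamped f)"
        by (rule continuous_on_eq[of _ "\<lambda>_. f 0"]) (auto simp: clamped_def)
      with 1 show ?thesis by (auto simp: continuous_on_eq_continuous_at)
    next
      case 2
      have "continuous_on {1<..} (clamped f)"
        by (rule continuous_on_eq[of _ "\<lambda>_. f 1"]) (auto simp: clamped_def)
      with 2 show ?thesis by (auto simp: continuous_on_eq_continuous_at)
    next
      case 3
      show ?thesis
        unfolding continuous_at_eps_delta
      proof (intro allI impI)
        fix e :: real assume "0 < e"
        then obtain m where m: "1 / real (Suc m) < e"
          using nat_approx_posE by blast
        obtain d where d: "0 < d" "\<And>y. \<bar>y - x\<bar> < d \<Longrightarrow> \<bar>f y - f x\<bar> < 1 / real (Suc m)"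
          using 3 by (fastforce simp: D_def not_le)
        show "\<exists>d>0. \<forall>x'. dist x' x < d \<longrightarrow> dist (clamped f x') (clamped f x) < e"
        proof (intro exI[of _ "min d (min x (1 - x))"] conjI allI impI)
          fix x' assume "dist x' x < min d (min x (1 - x))"
          then have "\<bar>f x' - f x\<bar> < e" "x' \<in> {0..1}"
            using d(2)[of x'] m 3 by (auto simp: dist_real_def)
          then show "dist (clamped f x') (clamped f x) < e"
            using 3 by (simp add: dist_real_def)
        qed (use d 3 in auto)
      qed
    qed
  qed
  ultimately show ?thesis by (rule borel_measurable_continuous_countable_exceptions)
qed

section \<open>The sequence of maxima in the criterion\<close>

locale waterman_shiba =
  fixes \<Lambda> :: "nat \<Rightarrow> real" and p q :: real
  assumes p: "1 \<le> p" and q: "1 \<le> q"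
    and \<Lambda>_mono: "mono_on {1..} \<Lambda>"
    and \<Lambda>_pos: "\<And>i. 1 \<le> i \<Longrightarrow> 0 < \<Lambda> i"
    and divergent: "filterlim (\<lambda>n. \<Sum>i=1..n. 1 / \<Lambda> i) at_top sequentially"
begin

definition recip_sum :: "nat \<Rightarrow> real" where
  "recip_sum k = (\<Sum>i=1..k. 1 / \<Lambda> i)"

definition max_ratio :: "nat \<Rightarrow> real" where
  "max_ratio n = (MAX k\<in>{1..n}. real k powr (1 / q) / recip_sum k powr (1 / p))"

lemma weight_antimono: "1 \<le> i \<Longrightarrow> i \<le> j \<Longrightarrow> 1 / \<Lambda> j \<le> 1 / \<Lambda> i"
  using mono_onD[OF \<Lambda>_mono, of i j] \<Lambda>_pos[of i] by (simp add: frac_le)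

lemma recip_sum_pos: "1 \<le> k \<Longrightarrow> 0 < recip_sum k"
  unfolding recip_sum_def using \<Lambda>_pos by (intro sum_pos) auto

lemma recip_sum_mono: "j \<le> k \<Longrightarrow> recip_sum j \<le> recip_sum k"
  unfolding recip_sum_def using \<Lambda>_pos by (intro sum_mono2) (auto intro: less_imp_le)

lemma recip_sum_double: "recip_sum (2 * k) \<le> 2 * recip_sum k"
proof (cases "k = 0")
  case False
  then show ?thesis
    using prefix_average_antimono[of "\<lambda>i. 1 / \<Lambda> i" k "2 * k"] weight_antimono
    by (simp add: recip_sum_def)
qed (simp add: recip_sum_def)

lemma max_ratio_ge: "1 \<le> k \<Longrightarrow> k \<le> n \<Longrightarrow> real k powr (1 / q) / recip_sum k powr (1 / p) \<le> max_ratio n"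
  unfolding max_ratio_def by (intro Max_ge) auto

lemma max_ratio_attained:
  assumes "1 \<le> n"
  obtains k where "1 \<le> k" "k \<le> n" "max_ratio n = real k powr (1 / q) / recip_sum k powr (1 / p)"
proof -
  have "max_ratio n \<in> (\<lambda>k. real k powr (1 / q) / recip_sum k powr (1 / p)) ` {1..n}"
    unfolding max_ratio_def using assms by (intro Max_in) auto
  then show ?thesis using that by auto
qed

lemma max_ratio_pos:
  assumes "1 \<le> n" shows "0 < max_ratio n"
proof -
  have "0 < real 1 powr (1 / q) / recip_sum 1 powr (1 / p)" using recip_sum_pos[of 1] by simp
  also have "\<dots> \<le> max_ratio n" using max_ratio_ge[of 1 n] assms by simp
  finally show ?thesis .
qed

lemma max_ratio_mono: "1 \<le> m \<Longrightarrow> m \<le> n \<Longrightarrow> max_ratio m \<le> max_ratio n"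
  using max_ratio_attained[of m] max_ratio_ge[of _ n] by (metis order_trans)

text \<open>
  If the maximum for \<^term>\<open>N\<close> is attained at some \<open>k > n\<close>, then \<open>k / N \<le> 1\<close>, and shrinking both
  \<open>k\<close> and \<open>N\<close> to \<open>n\<close> only decreases the denominator \<^term>\<open>recip_sum k\<close>. Thus a translation by less
  than \<open>1 / n\<close> is never worse than one by \<open>1 / n\<close>.
\<close>

lemma normalized_max_ratio_antimono:
  assumes "1 \<le> n" "n \<le> N"
  shows "max_ratio N / real N powr (1 / q) \<le> max_ratio n / real n powr (1 / q)"
proof -
  obtain k where k: "1 \<le> k" "k \<le> N" "max_ratio N = real k powr (1 / q) / recip_sum k powr (1 / p)"
    using max_ratio_attained[of N] assms by auto
  show ?thesis
  proof (cases "k \<le> n")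
    case True
    have "max_ratio N \<le> max_ratio n" using max_ratio_ge[OF k(1) True] k(3) by simp
    then show ?thesis
      using assms q max_ratio_pos[of n] by (intro frac_le powr_mono2) auto
  next
    case False
    have "max_ratio N / real N powr (1 / q) = (real k powr (1 / q) / real N powr (1 / q)) * (1 / recip_sum k powr (1 / p))"
      using k by simp
    also have "\<dots> \<le> 1 * (1 / recip_sum n powr (1 / p))"
    proof (intro mult_mono)
      show "real k powr (1 / q) / real N powr (1 / q) \<le> 1"
        using k q by (simp add: powr_mono2)
      show "1 / recip_sum k powr (1 / p) \<le> 1 / recip_sum n powr (1 / p)"
        using recip_sum_pos[of n] recip_sum_mono[of n k] False assms p
        by (intro divide_left_mono powr_mono2 mult_pos_pos) auto
    qed auto
    also have "\<dots> = (real n powr (1 / q) / recip_sum n powr (1 / p)) / real n powr (1 / q)"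
      using assms by simp
    also have "\<dots> \<le> max_ratio n / real n powr (1 / q)"
      using max_ratio_ge[of n n] assms by (intro divide_right_mono) auto
    finally show ?thesis .
  qed
qed

section \<open>Bounding the integral modulus\<close>

text \<open>
  The extremal problem for the \<open>p\<close>-th powers of the increments with exponent \<open>r = q / p\<close>.
\<close>

lemma sum_increment_powr_le:
  assumes K: "endpoint_variation_bound \<Lambda> p f K"
    and A: "finite A" "A \<noteq> {}" "nonoverlapping_endpoints A a b"
  shows "(\<Sum>i\<in>A. \<bar>f (b i) - f (a i)\<bar> powr q) \<le> K powr (q / p) * max_ratio (card A) powr q"
proof -
  let ?n = "card A"
  obtain \<rho> where \<rho>: "bij_betw \<rho> {1..?n} A"
    and dec: "\<And>i j. 1 \<le> i \<Longrightarrow> i \<le> j \<Longrightarrow> j \<le> ?n \<Longrightarrow>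
        \<bar>f (b (\<rho> j)) - f (a (\<rho> j))\<bar> powr p \<le> \<bar>f (b (\<rho> i)) - f (a (\<rho> i))\<bar> powr p"
    using ex_decreasing_enumeration[OF A(1), of "\<lambda>i. \<bar>f (b i) - f (a i)\<bar> powr p"] by blast
  define y where "y i = \<bar>f (b (\<rho> i)) - f (a (\<rho> i))\<bar> powr p" for i
  have "(\<Sum>i\<in>A. \<bar>f (b i) - f (a i)\<bar> powr q) = (\<Sum>i=1..?n. y i powr (q / p))"
    using p by (simp add: y_def powr_powr sum.reindex_bij_betw[OF \<rho>, symmetric])
  also have "\<dots> \<le> K powr (q / p) * max_ratio ?n powr q"
  proof (rule sum_powr_le_of_decreasing_weighted_sum[where \<mu> = "\<lambda>i. 1 / \<Lambda> i"])
    show "1 \<le> ?n" using A by (simp add: Suc_le_eq card_gt_0_iff)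
    show "(\<Sum>i=1..?n. y i * (1 / \<Lambda> i)) \<le> K"
      using endpoint_variation_bound_reindexed[OF K A(3) \<rho>] by (simp add: y_def)
    fix k assume k: "1 \<le> k" "k \<le> ?n"
    have "real k / recip_sum k powr (q / p) = (real k powr (1 / q) / recip_sum k powr (1 / p)) powr q"
      using q k recip_sum_pos[OF k(1)] by (simp add: powr_divide powr_powr)
    also have "\<dots> \<le> max_ratio ?n powr q"
      using max_ratio_ge[OF k] q by (intro powr_mono2) auto
    finally show "real k / (\<Sum>i=1..k. 1 / \<Lambda> i) powr (q / p) \<le> max_ratio ?n powr q"
      by (simp add: recip_sum_def)
  qed (use p q dec weight_antimono \<Lambda>_pos in \<open>auto simp: y_def\<close>)
  finally show ?thesis .
qed

text \<open>
  The grid \<open>t, t + \<gamma>, t + 2\<gamma>, \<dots>\<close> cuts the unit interval into nonoverlapping intervals.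
\<close>

lemma sum_translated_increments_powr_le:
  assumes K: "endpoint_variation_bound \<Lambda> p f K" and "0 < \<gamma>" "1 \<le> N"
  shows "(\<Sum>j<N. \<bar>clamped f (t + real j * \<gamma> + \<gamma>) - clamped f (t + real j * \<gamma>)\<bar> powr q)
           \<le> K powr (q / p) * max_ratio N powr q"
proof -
  define c where "c j = max 0 (min 1 (t + real j * \<gamma>))" for j :: nat
  have mono: "c i \<le> c j" if "i \<le> j" for i j
  proof -
    have "real i * \<gamma> \<le> real j * \<gamma>" using that assms by simp
    then show ?thesis by (auto simp: c_def)
  qed
  have "nonoverlapping_endpoints {..<N} c (\<lambda>j. c (Suc j))"
    unfolding nonoverlapping_endpoints_def
  proof
    show "\<forall>i\<in>{..<N}. 0 \<le> c i \<and> c i \<le> c (Suc i) \<and> c (Suc i) \<le> 1"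
      using mono[of i "Suc i" for i] by (auto simp: c_def simp del: of_nat_Suc)
    show "disjoint_family_on (\<lambda>i. {c i<..<c (Suc i)}) {..<N}"
      unfolding disjoint_family_on_def
    proof (intro ballI impI)
      fix i j :: nat assume "i \<noteq> j"
      then have "c (Suc i) \<le> c j \<or> c (Suc j) \<le> c i"
        using mono[of "Suc i" j] mono[of "Suc j" i] by linarith
      then show "{c i<..<c (Suc i)} \<inter> {c j<..<c (Suc j)} = {}" by auto
    qed
  qed
  from sum_increment_powr_le[OF K _ _ this] assms(3)
  have "(\<Sum>j<N. \<bar>f (c (Suc j)) - f (c j)\<bar> powr q) \<le> K powr (q / p) * max_ratio N powr q"
    by (auto simp: lessThan_empty_iff)
  then show ?thesis by (simp add: c_def clamped_def algebra_simps)
qed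

end

text \<open>
  Folding an integral over \<open>N\<close> periods into one period: the \<open>\<gamma>\<close>-increments on the right are then
  consecutive increments along one grid.
\<close>

lemma nn_integral_translates:
  fixes H :: "real \<Rightarrow> ennreal"
  assumes [measurable]: "H \<in> borel_measurable borel" and "0 \<le> \<gamma>"
  shows "(\<integral>\<^sup>+t. H t * indicator {0..<real N * \<gamma>} t \<partial>lborel)
           = (\<integral>\<^sup>+t. (\<Sum>j<N. H (t + real j * \<gamma>)) * indicator {0..<\<gamma>} t \<partial>lborel)"
proof (induction N)
  case (Suc N)
  let ?c = "real N * \<gamma>"
  have "(\<integral>\<^sup>+t. H t * indicator {0..<real (Suc N) * \<gamma>} t \<partial>lborel)
      = (\<integral>\<^sup>+t. H t * indicator {0..<?c} t + H t * indicator {?c..<?c + \<gamma>} t \<partial>lborel)"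
  proof (rule nn_integral_cong)
    fix t :: real
    have split: "indicator {0..<c + \<gamma>} t = (indicator {0..<c} t + indicator {c..<c + \<gamma>} t :: ennreal)"
      if "0 \<le> c" for c
      using that assms(2) by (auto simp: indicator_def)
    have "real (Suc N) * \<gamma> = ?c + \<gamma>" by (simp add: algebra_simps)
    then show "H t * indicator {0..<real (Suc N) * \<gamma>} t
        = H t * indicator {0..<?c} t + H t * indicator {?c..<?c + \<gamma>} t"
      using assms(2) by (simp add: split distrib_left)
  qed
  also have "\<dots> = (\<integral>\<^sup>+t. H t * indicator {0..<?c} t \<partial>lborel)
      + (\<integral>\<^sup>+t. H t * indicator {?c..<?c + \<gamma>} t \<partial>lborel)"
    by (rule nn_integral_add) auto
  also have "(\<integral>\<^sup>+t. H t * indicator {?c..<?c + \<gamma>} t \<partial>lborel)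
      = (\<integral>\<^sup>+t. H (t + ?c) * indicator {0..<\<gamma>} t \<partial>lborel)"
    by (subst nn_integral_real_affine[where c = 1 and t = ?c])
       (auto intro!: nn_integral_cong simp: indicator_def add.commute)
  also note Suc.IH
  also have "(\<integral>\<^sup>+t. (\<Sum>j<N. H (t + real j * \<gamma>)) * indicator {0..<\<gamma>} t \<partial>lborel)
      + (\<integral>\<^sup>+t. H (t + ?c) * indicator {0..<\<gamma>} t \<partial>lborel)
      = (\<integral>\<^sup>+t. (\<Sum>j<N. H (t + real j * \<gamma>)) * indicator {0..<\<gamma>} t
           + H (t + ?c) * indicator {0..<\<gamma>} t \<partial>lborel)"
    by (rule nn_integral_add[symmetric]) auto
  also have "\<dots> = (\<integral>\<^sup>+t. (\<Sum>j<Suc N. H (t + real j * \<gamma>)) * indicator {0..<\<gamma>} t \<partial>lborel)"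
    by (simp add: distrib_right)
  finally show ?case .
qed simp

lemma nn_integral_shift_eq_clamped:
  assumes "0 \<le> \<gamma>"
  shows "(\<integral>\<^sup>+t. ennreal (\<bar>f (t + \<gamma>) - f t\<bar> powr q) \<partial>lebesgue_on {0..1 - \<gamma>})
    = (\<integral>\<^sup>+t. ennreal (\<bar>clamped f (t + \<gamma>) - clamped f t\<bar> powr q) * indicator {0..1 - \<gamma>} t \<partial>lborel)"
  using assms
  by (subst nn_integral_restrict_space)
     (auto simp: nn_integral_completion indicator_def intro!: nn_integral_cong)

context waterman_shiba
begin

text \<open>
  After folding, the integrand on a single period of length \<open>\<gamma>\<close> is bounded pointwise by the
  extremal problem. The hypothesis on \<^term>\<open>N\<close> says that \<^term>\<open>N\<close> periods cover \<open>[0, 1 - \<gamma>]\<close>.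
\<close>

lemma integral_shift_powr_le:
  assumes K: "endpoint_variation_bound \<Lambda> p f K"
    and \<gamma>: "0 < \<gamma>" and N: "1 \<le> N" "1 \<le> real (Suc N) * \<gamma>"
  shows "(LINT t|lebesgue_on {0..1 - \<gamma>}. \<bar>f (t + \<gamma>) - f t\<bar> powr q)
           \<le> \<gamma> * (K powr (q / p) * max_ratio N powr q)"
proof (rule integral_real_bounded)
  let ?C = "K powr (q / p) * max_ratio N powr q"
  have [measurable]: "clamped f \<in> borel_measurable borel"
    by (rule borel_measurable_clamped[OF \<Lambda>_pos divergent p K])
  define H where "H t = ennreal (\<bar>clamped f (t + \<gamma>) - clamped f t\<bar> powr q)" for t
  have [measurable]: "H \<in> borel_measurable borel" unfolding H_def by measurable
  have "(\<integral>\<^sup>+t. ennreal (\<bar>f (t + \<gamma>) - f t\<bar> powr q) \<partial>lebesgue_on {0..1 - \<gamma>})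
      = (\<integral>\<^sup>+t. H t * indicator {0..1 - \<gamma>} t \<partial>lborel)"
    using \<gamma> by (simp add: nn_integral_shift_eq_clamped H_def)
  also have "\<dots> \<le> (\<integral>\<^sup>+t. H t * indicator {0..real N * \<gamma>} t \<partial>lborel)"
    using N by (intro nn_integral_mono) (auto simp: indicator_def algebra_simps)
  also have "\<dots> = (\<integral>\<^sup>+t. H t * indicator {0..<real N * \<gamma>} t \<partial>lborel)"
    by (rule nn_integral_cong_AE, rule AE_mp[OF AE_lborel_singleton[of "real N * \<gamma>"]])
       (auto simp: indicator_def)
  also have "\<dots> = (\<integral>\<^sup>+t. (\<Sum>j<N. H (t + real j * \<gamma>)) * indicator {0..<\<gamma>} t \<partial>lborel)"
    using \<gamma> by (intro nn_integral_translates) auto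
  also have "\<dots> \<le> (\<integral>\<^sup>+t. ennreal ?C * indicator {0..<\<gamma>} t \<partial>lborel)"
  proof (intro nn_integral_mono mult_right_mono)
    fix t
    have "(\<Sum>j<N. H (t + real j * \<gamma>)) = ennreal (\<Sum>j<N.
        \<bar>clamped f (t + real j * \<gamma> + \<gamma>) - clamped f (t + real j * \<gamma>)\<bar> powr q)"
      unfolding H_def by (intro sum_ennreal) auto
    also have "\<dots> \<le> ennreal ?C"
      by (intro ennreal_leI sum_translated_increments_powr_le K \<gamma> N)
    finally show "(\<Sum>j<N. H (t + real j * \<gamma>)) \<le> ennreal ?C" .
  qed auto
  also have "\<dots> = ennreal (\<gamma> * ?C)"
    using \<gamma> by (subst nn_integral_cmult_indicator) (auto simp: ennreal_mult' mult.commute)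
  finally show "(\<integral>\<^sup>+t. ennreal (\<bar>f (t + \<gamma>) - f t\<bar> powr q) \<partial>lebesgue_on {0..1 - \<gamma>})
      \<le> ennreal (\<gamma> * ?C)" .
qed (use \<gamma> in auto)

text \<open>
  A translation by \<open>\<gamma> \<le> \<delta>\<close> involves about \<open>N = 1 / \<gamma>\<close> periods, possibly many more than \<^term>\<open>n\<close>, but the
  normalized maximum only decreases.
\<close>

lemma integral_modulus_le:
  assumes K: "endpoint_variation_bound \<Lambda> p f K" and K0: "0 \<le> K"
    and n: "1 \<le> n" and \<delta>: "0 < \<delta>" "\<delta> \<le> 1 / real n"
  shows "integral_modulus q \<delta> f \<le> K powr (1 / p) * (max_ratio n / real n powr (1 / q))"
  unfolding integral_modulus_def
proof (rule cSUP_least)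
  fix \<gamma> assume "\<gamma> \<in> {0..\<delta>}"
  then consider "\<gamma> = 0" | "0 < \<gamma>" "\<gamma> \<le> \<delta>" by fastforce
  then show "(LINT t|lebesgue_on {0..1 - \<gamma>}. \<bar>f (t + \<gamma>) - f t\<bar> powr q) powr (1 / q)
      \<le> K powr (1 / p) * (max_ratio n / real n powr (1 / q))"
  proof cases
    case 1
    then show ?thesis using max_ratio_pos[OF n] by simp
  next
    case 2
    define N where "N = nat \<lfloor>1 / \<gamma>\<rfloor>"
    have "real n \<le> 1 / \<gamma>"
    proof -
      have "real n * \<gamma> \<le> real n * (1 / real n)" using 2 \<delta> by (intro mult_left_mono) auto
      then show ?thesis using 2 n by (simp add: pos_le_divide_eq)
    qed
    then have nN: "n \<le> N" unfolding N_def by linarith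
    have "0 \<le> 1 / \<gamma>" using 2 by simp
    then have N: "real N \<le> 1 / \<gamma>" "1 / \<gamma> < real N + 1"
      unfolding N_def by linarith+
    then have N': "real N * \<gamma> \<le> 1" "1 \<le> real (Suc N) * \<gamma>"
      using 2 by (auto simp: field_simps)
    have "(LINT t|lebesgue_on {0..1 - \<gamma>}. \<bar>f (t + \<gamma>) - f t\<bar> powr q)
        \<le> \<gamma> * (K powr (q / p) * max_ratio N powr q)"
      using n nN 2 N' by (intro integral_shift_powr_le K) auto
    also have "\<dots> \<le> (1 / real N) * (K powr (q / p) * max_ratio N powr q)"
      using N' n nN by (intro mult_right_mono) (auto simp: field_simps)
    finally have "(LINT t|lebesgue_on {0..1 - \<gamma>}. \<bar>f (t + \<gamma>) - f t\<bar> powr q) powr (1 / q)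
        \<le> ((1 / real N) * (K powr (q / p) * max_ratio N powr q)) powr (1 / q)"
      using q by (intro powr_mono2) auto
    also have "\<dots> = K powr (1 / p) * (max_ratio N / real N powr (1 / q))"
      using q K0 max_ratio_pos[of N] n nN by (simp add: powr_mult powr_powr powr_divide)
    also have "\<dots> \<le> K powr (1 / p) * (max_ratio n / real n powr (1 / q))"
      using normalized_max_ratio_antimono[OF n nN] by (intro mult_left_mono) auto
    finally show ?thesis .
  qed
qed (use \<delta> in auto)

lemma Lq01_if_endpoint_variation_bound:
  assumes K: "endpoint_variation_bound \<Lambda> p f K"
  shows "f \<in> Lq01 q"
proof -
  have "clamped f \<in> borel_measurable (lebesgue_on {0..1})"
    using borel_measurable_clamped[OF \<Lambda>_pos divergent p K]
    by (simp add: measurable_completion measurable_restrict_space1)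
  then have meas: "f \<in> borel_measurable (lebesgue_on {0..1})"
    by (subst measurable_cong[where g = "clamped f"]) auto
  obtain B where B: "\<And>x. x \<in> {0..1} \<Longrightarrow> \<bar>f x\<bar> \<le> B"
    using bounded_if_endpoint_variation_bound[OF p \<Lambda>_pos[OF order_refl] K] by blast
  interpret finite_measure "lebesgue_on {0..1::real}"
    by (rule finite_measure_lebesgue_on) auto
  have "integrable (lebesgue_on {0..1}) (\<lambda>t. \<bar>f t\<bar> powr q)"
  proof (rule integrable_const_bound[where B = "B powr q"])
    show "AE x in lebesgue_on {0..1}. norm (\<bar>f x\<bar> powr q) \<le> B powr q"
      using B q by (intro AE_I2) (auto intro!: powr_mono2)
  qed (use meas in measurable)
  with meas show ?thesis by (simp add: Lq01_def)
qed

text \<open>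
  The supremum in the integral modulus is a real one, so it dominates its members only because
  bounded functions keep the set of integrals bounded.
\<close>

lemma integral_modulus_ge:
  assumes K: "endpoint_variation_bound \<Lambda> p f K" and \<gamma>: "0 \<le> \<gamma>" "\<gamma> \<le> \<delta>" and "\<delta> \<le> 1"
  shows "(LINT t|lebesgue_on {0..1 - \<gamma>}. \<bar>f (t + \<gamma>) - f t\<bar> powr q) powr (1 / q)
           \<le> integral_modulus q \<delta> f"
proof -
  obtain B where B: "\<And>x. x \<in> {0..1} \<Longrightarrow> \<bar>f x\<bar> \<le> B"
    using bounded_if_endpoint_variation_bound[OF p \<Lambda>_pos[OF order_refl] K] by blast
  have B0: "0 \<le> B" using B[of 0] by auto
  have "(LINT t|lebesgue_on {0..1 - \<gamma>}. \<bar>f (t + \<gamma>) - f t\<bar> powr q) \<le> (2 * B) powr q"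
    if "\<gamma> \<in> {0..\<delta>}" for \<gamma>
  proof (rule integral_real_bounded)
    have "(\<integral>\<^sup>+t. ennreal (\<bar>f (t + \<gamma>) - f t\<bar> powr q) \<partial>lebesgue_on {0..1 - \<gamma>})
        \<le> (\<integral>\<^sup>+t. ennreal ((2 * B) powr q) \<partial>lebesgue_on {0..1 - \<gamma>})"
    proof (intro nn_integral_mono ennreal_leI powr_mono2)
      fix t assume "t \<in> space (lebesgue_on {0..1 - \<gamma>})"
      then have "\<bar>f (t + \<gamma>)\<bar> \<le> B" "\<bar>f t\<bar> \<le> B" using that by (auto intro!: B)
      then show "\<bar>f (t + \<gamma>) - f t\<bar> \<le> 2 * B" by linarith
    qed (use q in auto)
    also have "\<dots> = ennreal ((2 * B) powr q) * ennreal (1 - \<gamma>)"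
      using that \<open>\<delta> \<le> 1\<close> by (simp add: emeasure_restrict_space)
    also have "\<dots> \<le> ennreal ((2 * B) powr q) * ennreal 1"
      using that by (intro mult_left_mono ennreal_leI) auto
    finally show "(\<integral>\<^sup>+t. ennreal (\<bar>f (t + \<gamma>) - f t\<bar> powr q) \<partial>lebesgue_on {0..1 - \<gamma>})
        \<le> ennreal ((2 * B) powr q)" by simp
  qed auto
  then have "bdd_above ((\<lambda>\<gamma>. (LINT t|lebesgue_on {0..1 - \<gamma>}. \<bar>f (t + \<gamma>) - f t\<bar> powr q) powr (1 / q)) ` {0..\<delta>})"
    using q by (intro bdd_aboveI2[where M = "((2 * B) powr q) powr (1 / q)"] powr_mono2) auto
  then show ?thesis
    unfolding integral_modulus_def using \<gamma> by (intro cSUP_upper) auto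
qed

text \<open>
  Given \<open>\<delta>\<close>, choose \<open>n\<close> with \<open>1 / (n + 1) < \<delta> \<le> 1 / n\<close>. The bound on the integral modulus uses \<open>n\<close>, while
  monotonicity of \<open>\<omega>\<close> requires \<open>n + 1\<close>; passing from one to the other costs a factor of at most 2.
\<close>

lemma Waterman_Shiba_subset_H_class_if:
  assumes \<omega>: "modulus_of_continuity \<omega>"
    and C: "eventually (\<lambda>n. max_ratio n / real n powr (1 / q) \<le> C * \<omega> (1 / real n)) sequentially"
  shows "Waterman_Shiba \<Lambda> p \<subseteq> H_class \<omega> q"
proof
  fix f assume "f \<in> Waterman_Shiba \<Lambda> p"
  then obtain K0 where "endpoint_variation_bound \<Lambda> p f K0"
    using Waterman_Shiba_iff_endpoint_variation[of p \<Lambda> f, OF p \<Lambda>_pos] by blast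
  then have K: "endpoint_variation_bound \<Lambda> p f \<bar>K0\<bar>"
    unfolding endpoint_variation_bound_def by (meson abs_ge_self order_trans)
  define K where "K = \<bar>K0\<bar>"
  have K0: "0 \<le> K" and K: "endpoint_variation_bound \<Lambda> p f K" using K by (simp_all add: K_def)
  obtain n0 where n0: "\<And>n. n0 \<le> n \<Longrightarrow> max_ratio n / real n powr (1 / q) \<le> C * \<omega> (1 / real n)"
    using C by (auto simp: eventually_sequentially)
  have \<omega>_mono: "\<omega> s \<le> \<omega> t" if "0 \<le> s" "s \<le> t" "t \<le> 1" for s t
    using \<omega> that by (auto simp: modulus_of_continuity_def intro: mono_onD)
  have \<omega>_nonneg: "0 \<le> \<omega> s" if "0 \<le> s" "s \<le> 1" for s
    using \<omega>_mono[of 0 s] \<omega> that by (auto simp: modulus_of_continuity_def)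
  define d where "d = 1 / real (Suc n0)"
  have d: "0 < d" "d \<le> 1" by (auto simp: d_def)
  have bound: "norm (integral_modulus q \<delta> f) \<le> (K powr (1 / p) * (2 * \<bar>C\<bar>)) * norm (\<omega> \<delta>)"
    if \<delta>: "0 < \<delta>" "\<delta> < d" for \<delta>
  proof -
    define n where "n = nat \<lfloor>1 / \<delta>\<rfloor>"
    have d1: "real (Suc n0) < 1 / \<delta>" using \<delta> by (simp add: d_def field_simps)
    have n: "real n \<le> 1 / \<delta>" "1 / \<delta> < real (Suc n)"
      unfolding n_def using \<delta> by (simp_all add: of_nat_floor) linarith
    then have n1: "1 \<le> n" "n0 \<le> Suc n" using d1 by linarith+
    have \<delta>n: "\<delta> \<le> 1 / real n" "1 / real (Suc n) \<le> \<delta>"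
      using n n1 \<delta> by (auto simp: field_simps)
    have "real (Suc n) powr (1 / q) \<le> (2 * real n) powr (1 / q)"
      using n1 q by (intro powr_mono2) auto
    also have "\<dots> = 2 powr (1 / q) * real n powr (1 / q)" by (simp add: powr_mult)
    also have "\<dots> \<le> 2 * real n powr (1 / q)"
      using powr_mono[of "1 / q" 1 2] q by (intro mult_right_mono) auto
    finally have step: "real (Suc n) powr (1 / q) \<le> 2 * real n powr (1 / q)" .
    have "max_ratio n / real n powr (1 / q) \<le> max_ratio (Suc n) / (real (Suc n) powr (1 / q) / 2)"
      using step n1 max_ratio_mono[of n "Suc n"] max_ratio_pos[of "Suc n"] by (intro frac_le) auto
    also have "\<dots> = 2 * (max_ratio (Suc n) / real (Suc n) powr (1 / q))" by simp
    also have "\<dots> \<le> 2 * (C * \<omega> (1 / real (Suc n)))"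
      using n0[OF n1(2)] by (intro mult_left_mono) auto
    also have "\<dots> \<le> 2 * (\<bar>C\<bar> * \<omega> \<delta>)"
      using \<delta>n \<delta> d by (intro mult_left_mono mult_mono \<omega>_mono \<omega>_nonneg) auto
    finally have max_ratio\<omega>: "max_ratio n / real n powr (1 / q) \<le> 2 * (\<bar>C\<bar> * \<omega> \<delta>)" .
    have "integral_modulus q \<delta> f \<le> K powr (1 / p) * (max_ratio n / real n powr (1 / q))"
      by (rule integral_modulus_le[OF K K0 n1(1) \<delta>(1) \<delta>n(1)])
    also have "\<dots> \<le> K powr (1 / p) * (2 * (\<bar>C\<bar> * \<omega> \<delta>))"
      using max_ratio\<omega> by (intro mult_left_mono) auto
    finally have "integral_modulus q \<delta> f \<le> K powr (1 / p) * (2 * \<bar>C\<bar>) * \<omega> \<delta>" by simp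
    moreover have "0 \<le> integral_modulus q \<delta> f"
      by (rule order_trans[OF powr_ge_zero integral_modulus_ge[OF K, of 0]]) (use \<delta> d in auto)
    moreover have "0 \<le> \<omega> \<delta>" using \<delta> d by (intro \<omega>_nonneg) auto
    ultimately show ?thesis by simp
  qed
  have "eventually (\<lambda>\<delta>. 0 < \<delta> \<and> \<delta> < d) (at_right 0)"
    using d by (auto simp: eventually_at_right_field)
  then have "(\<lambda>\<delta>. integral_modulus q \<delta> f) \<in> O[at_right 0](\<omega>)"
    by (intro bigoI[where c = "K powr (1 / p) * (2 * \<bar>C\<bar>)"]) (auto elim!: eventually_mono dest: bound)
  then show "f \<in> H_class \<omega> q"
    using Lq01_if_endpoint_variation_bound[OF K] by (simp add: H_class_def)
qed

end

section \<open>Step functions with few jumps\<close>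

lemma sum_le_sum_initial_segment:
  fixes \<mu> :: "nat \<Rightarrow> real"
  assumes dec: "\<And>i j. 1 \<le> i \<Longrightarrow> i \<le> j \<Longrightarrow> \<mu> j \<le> \<mu> i" and "finite F" "F \<subseteq> {1..}"
  shows "(\<Sum>i\<in>F. \<mu> i) \<le> (\<Sum>i=1..card F. \<mu> i)"
  using assms(2,3)
proof (induction F rule: finite_linorder_max_induct)
  case (insert b A)
  have "A \<subseteq> {1..<b}" using insert by auto
  then have "card A \<le> b - 1" using card_mono[of "{1..<b}" A] by simp
  moreover have "1 \<le> b" using insert by simp
  ultimately have "\<mu> b \<le> \<mu> (Suc (card A))" by (intro dec) auto
  moreover have "b \<notin> A" using insert by auto
  ultimately show ?case using insert by simp
qed simp

context waterman_shiba
begin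

text \<open>
  If \<open>u\<close> is increasing and takes at most \<open>N + 1\<close> consecutive integer values, at most \<open>N\<close> of the
  nonoverlapping intervals can see \<open>u\<close> change, because the values at their right end points are distinct
  and never minimal. Their total weight is largest for the indices \<open>1, \<dots>, N\<close>.
\<close>

lemma endpoint_variation_bound_step:
  fixes u :: "real \<Rightarrow> int" and g :: "int \<Rightarrow> real"
  assumes u: "mono u" "\<And>t. u t \<in> {m..m + int N}"
    and h: "0 \<le> h" "\<And>i j. \<bar>g i - g j\<bar> \<le> h"
  shows "endpoint_variation_bound \<Lambda> p (\<lambda>t. g (u t)) (h powr p * recip_sum N)"
  unfolding endpoint_variation_bound_def
proof (intro allI impI)
  fix n :: nat and a b
  assume ab: "nonoverlapping_endpoints {1..n} a b"
  define F where "F = {i\<in>{1..n}. u (a i) < u (b i)}"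
  have F: "finite F" "F \<subseteq> {1..}" by (auto simp: F_def)
  have le: "a i \<le> b i" if "i \<in> {1..n}" for i
    using ab that by (simp add: nonoverlapping_endpoints_def)
  have jump: "a i < b i" if "i \<in> F" for i
    using that le[of i] by (force simp: F_def less_le)
  have "inj_on (\<lambda>i. u (b i)) F"
  proof (rule inj_onI, rule ccontr)
    fix i j assume ij: "i \<in> F" "j \<in> F" "u (b i) = u (b j)" "i \<noteq> j"
    have "{a i<..<b i} \<inter> {a j<..<b j} = {}"
      using ab ij by (auto simp: nonoverlapping_endpoints_def disjoint_family_on_def F_def)
    then have "b i \<le> a j \<or> b j \<le> a i"
      using jump[OF ij(1)] jump[OF ij(2)]
      by (auto simp: Int_greaterThanLessThan max_def min_def split: if_splits)
    then have "u (b i) \<le> u (a j) \<or> u (b j) \<le> u (a i)"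
      using monoD[OF u(1)] by blast
    then show False using ij by (auto simp: F_def)
  qed
  moreover have "(\<lambda>i. u (b i)) ` F \<subseteq> {m + 1..m + int N}"
  proof (clarsimp simp: F_def)
    fix i assume "u (a i) < u (b i)"
    then show "m + 1 \<le> u (b i) \<and> u (b i) \<le> m + int N"
      using u(2)[of "a i"] u(2)[of "b i"] by auto
  qed
  ultimately have "card F \<le> card {m + 1..m + int N}"
    by (rule card_inj_on_le) simp
  then have cF: "card F \<le> N" by simp
  have "(\<Sum>i=1..n. \<bar>g (u (b i)) - g (u (a i))\<bar> powr p / \<Lambda> i)
      = (\<Sum>i\<in>F. \<bar>g (u (b i)) - g (u (a i))\<bar> powr p / \<Lambda> i)"
  proof (rule sum.mono_neutral_right)
    show "\<forall>i\<in>{1..n} - F. \<bar>g (u (b i)) - g (u (a i))\<bar> powr p / \<Lambda> i = 0"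
    proof
      fix i assume i: "i \<in> {1..n} - F"
      then have "u (a i) = u (b i)" using monoD[OF u(1) le[of i]] by (auto simp: F_def)
      then show "\<bar>g (u (b i)) - g (u (a i))\<bar> powr p / \<Lambda> i = 0" by simp
    qed
  qed (auto simp: F_def)
  also have "\<dots> \<le> (\<Sum>i\<in>F. h powr p * (1 / \<Lambda> i))"
  proof (rule sum_mono)
    fix i assume "i \<in> F"
    then have "0 < \<Lambda> i" using F \<Lambda>_pos by auto
    moreover have "\<bar>g (u (b i)) - g (u (a i))\<bar> powr p \<le> h powr p"
      using h p by (intro powr_mono2) auto
    ultimately show "\<bar>g (u (b i)) - g (u (a i))\<bar> powr p / \<Lambda> i \<le> h powr p * (1 / \<Lambda> i)"
      by (simp add: divide_right_mono)
  qed
  also have "\<dots> = h powr p * (\<Sum>i\<in>F. 1 / \<Lambda> i)" by (simp add: sum_distrib_left)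
  also have "\<dots> \<le> h powr p * recip_sum (card F)"
    unfolding recip_sum_def by (intro mult_left_mono sum_le_sum_initial_segment weight_antimono F) auto
  also have "\<dots> \<le> h powr p * recip_sum N" using recip_sum_mono[OF cF] by (intro mult_left_mono) auto
  finally show "(\<Sum>i=1..n. \<bar>g (u (b i)) - g (u (a i))\<bar> powr p / \<Lambda> i) \<le> h powr p * recip_sum N" .
qed

end

text \<open>
  For \<open>n > 0\<close>, the indicator function of \<open>k\<close> intervals of length \<open>1 / (2n)\<close>, repeated with period \<open>1 / n\<close> from \<open>a\<close> on.
  Clamping the cell number to \<open>-1, \<dots>, 2k - 1\<close>, whose extreme values are odd, makes the function vanish
  outside and exhibits it as a function of a monotone integer-valued map.
\<close>

definition bumps :: "real \<Rightarrow> nat \<Rightarrow> nat \<Rightarrow> real \<Rightarrow> real" where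
  "bumps a n k t = of_bool (even (max (- 1) (min (2 * int k - 1) \<lfloor>2 * real n * (t - a)\<rfloor>)))"

lemma bumps_nonneg: "0 \<le> bumps a n k t"
  by (simp add: bumps_def)

lemma bumps_support:
  assumes "bumps a n k t \<noteq> 0" "1 \<le> n"
  shows "a \<le> t" "t < a + real k / real n"
proof -
  define j where "j = \<lfloor>2 * real n * (t - a)\<rfloor>"
  have "0 \<le> j \<and> j < 2 * int k - 1"
  proof (rule ccontr)
    assume "\<not> (0 \<le> j \<and> j < 2 * int k - 1)"
    then have "max (- 1) (min (2 * int k - 1) j) \<in> {- 1, 2 * int k - 1}"
      by (auto simp: max_def min_def)
    then have "odd (max (- 1) (min (2 * int k - 1) j))" by auto
    then show False using assms(1) by (simp add: bumps_def j_def)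
  qed
  then have j: "0 \<le> j" "j + 1 < 2 * int k" by auto
  have "0 \<le> 2 * real n * (t - a)" using j(1) by (simp add: j_def)
  then show "a \<le> t" using assms(2) by (simp add: zero_le_mult_iff)
  have "2 * real n * (t - a) < of_int j + 1" unfolding j_def by linarith
  also have "\<dots> < 2 * real k" using j(2) by linarith
  finally show "t < a + real k / real n" using assms(2) by (simp add: field_simps)
qed

text \<open>
  A translation by half a period moves every point to the next cell, of the other parity.
\<close>

lemma bumps_shift:
  assumes n: "1 \<le> n" and t: "a \<le> t" "t < a + (2 * real k - 1) / (2 * real n)"
  shows "\<bar>bumps a n k (t + 1 / (2 * real n)) - bumps a n k t\<bar> = 1"
proof -
  define j where "j = \<lfloor>2 * real n * (t - a)\<rfloor>"
  have "2 * real n * (t + 1 / (2 * real n) - a) = 2 * real n * (t - a) + 1"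
    using n by (simp add: field_simps)
  then have j': "\<lfloor>2 * real n * (t + 1 / (2 * real n) - a)\<rfloor> = j + 1"
    by (simp add: j_def)
  have "0 \<le> j" using t by (simp add: j_def)
  moreover have "2 * real n * (t - a) < 2 * real k - 1"
    using t n by (simp add: field_simps)
  then have "j < 2 * int k - 1" by (simp add: j_def floor_less_iff)
  ultimately show ?thesis by (simp add: bumps_def j' flip: j_def)
qed

context waterman_shiba
begin

text \<open>
  There are \<open>2k\<close> jumps of size \<open>h\<close>, and doubling the number of jumps at most doubles the sum of the
  weights, which decrease.
\<close>

lemma endpoint_variation_bound_bumps:
  assumes "1 \<le> n" "0 \<le> h"
  shows "endpoint_variation_bound \<Lambda> p (\<lambda>t. h * bumps a n k t) (2 * h powr p * recip_sum k)"
proof -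
  define u where "u t = max (- 1) (min (2 * int k - 1) \<lfloor>2 * real n * (t - a)\<rfloor>)" for t
  have "mono u"
    unfolding u_def by (intro monoI max.mono min.mono floor_mono mult_left_mono) auto
  moreover have "u t \<in> {- 1..- 1 + int (2 * k)}" for t
    by (auto simp: u_def)
  ultimately have "endpoint_variation_bound \<Lambda> p (\<lambda>t. h * of_bool (even (u t))) (h powr p * recip_sum (2 * k))"
    using assms(2) by (intro endpoint_variation_bound_step[where g = "\<lambda>j. h * of_bool (even j)"]) auto
  moreover have "h powr p * recip_sum (2 * k) \<le> 2 * h powr p * recip_sum k"
    using mult_left_mono[OF recip_sum_double[of k], of "h powr p"] by simp
  ultimately show ?thesis
    unfolding endpoint_variation_bound_def bumps_def u_def by (meson order_trans)
qed

end

section \<open>Gluing functions with disjoint supports\<close>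

text \<open>
  For nonnegative functions with disjoint supports this is their sum; where all of them vanish, the
  chosen index is arbitrary and the value is still 0.
\<close>

definition glue :: "(nat \<Rightarrow> real \<Rightarrow> real) \<Rightarrow> real \<Rightarrow> real" where
  "glue \<phi> t = \<phi> (SOME l. \<phi> l t \<noteq> 0) t"

lemma glue_eq:
  assumes disj: "disjoint_family J" and supp: "\<And>l t. \<phi> l t \<noteq> 0 \<Longrightarrow> t \<in> J l" and "t \<in> J l"
  shows "glue \<phi> t = \<phi> l t"
proof (cases "\<exists>l. \<phi> l t \<noteq> 0")
  case True
  then have ne: "\<phi> (SOME l. \<phi> l t \<noteq> 0) t \<noteq> 0" by (rule someI_ex)
  then have "(SOME l. \<phi> l t \<noteq> 0) = l"
    using disj supp[OF ne] assms(3) by (auto simp: disjoint_family_on_def)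
  then show ?thesis by (simp add: glue_def)
qed (simp add: glue_def)

text \<open>
  At each of the two points at most one of the functions is nonzero. If it is the same one, the
  increment is an increment of that function. Otherwise the increment is a difference of two
  nonnegative numbers, hence at most the larger of them, and each occurs as an increment of its own
  function. No constant depending on the number of functions is lost.
\<close>

lemma glue_increment_powr_le:
  fixes \<phi> :: "nat \<Rightarrow> real \<Rightarrow> real"
  assumes disj: "disjoint_family J" and supp: "\<And>l t. \<phi> l t \<noteq> 0 \<Longrightarrow> t \<in> J l"
    and nonneg: "\<And>l t. 0 \<le> \<phi> l t" and p: "0 \<le> p"
    and G: "finite G" "(SOME l. \<phi> l s \<noteq> 0) \<in> G" "(SOME l. \<phi> l t \<noteq> 0) \<in> G"
  shows "\<bar>glue \<phi> t - glue \<phi> s\<bar> powr p \<le> (\<Sum>l\<in>G. \<bar>\<phi> l t - \<phi> l s\<bar> powr p)"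
proof -
  \<comment> \<open>The index of the only function that can be nonzero at \<open>x\<close>.\<close>
  define L where "L x = (SOME l. \<phi> l x \<noteq> 0)" for x
  have glue: "glue \<phi> x = \<phi> (L x) x" for x by (simp add: glue_def L_def)
  have other: "\<phi> l x = 0" if "l \<noteq> L x" for l x
  proof (rule ccontr)
    assume ne: "\<phi> l x \<noteq> 0"
    then have "\<phi> (L x) x \<noteq> 0" unfolding L_def by (rule someI)
    from supp[OF ne] supp[OF this] show False
      using that disj unfolding disjoint_family_on_def by blast
  qed
  have LG: "L s \<in> G" "L t \<in> G" using G by (auto simp: L_def)
  show ?thesis
  proof (cases "L s = L t")
    case True
    then show ?thesis
      using member_le_sum[of "L t" G "\<lambda>l. \<bar>\<phi> l t - \<phi> l s\<bar> powr p"] LG G(1) by (simp add: glue)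
  next
    case False
    have "\<bar>glue \<phi> t - glue \<phi> s\<bar> powr p \<le> max (\<phi> (L t) t) (\<phi> (L s) s) powr p"
      using nonneg[of "L t" t] nonneg[of "L s" s] p by (intro powr_mono2) (auto simp: glue)
    also have "\<dots> \<le> \<phi> (L t) t powr p + \<phi> (L s) s powr p"
      by (simp add: max_def)
    also have "\<dots> = (\<Sum>l\<in>{L s, L t}. \<bar>\<phi> l t - \<phi> l s\<bar> powr p)"
      using False other[of "L s" t] other[of "L t" s] nonneg by simp
    also have "\<dots> \<le> (\<Sum>l\<in>G. \<bar>\<phi> l t - \<phi> l s\<bar> powr p)"
      using LG G(1) by (intro sum_mono2) auto
    finally show ?thesis .
  qed
qed

context waterman_shiba
begin

lemma endpoint_variation_bound_glue:
  assumes disj: "disjoint_family J" and supp: "\<And>l t. \<phi> l t \<noteq> 0 \<Longrightarrow> t \<in> J l"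
    and nonneg: "\<And>l t. 0 \<le> \<phi> l t"
    and c: "\<And>l. endpoint_variation_bound \<Lambda> p (\<phi> l) (c l)"
    and C: "\<And>G. finite G \<Longrightarrow> sum c G \<le> C"
  shows "endpoint_variation_bound \<Lambda> p (glue \<phi>) C"
  unfolding endpoint_variation_bound_def
proof (intro allI impI)
  fix n :: nat and a b assume ab: "nonoverlapping_endpoints {1..n} a b"
  define L where "L x = (SOME l. \<phi> l x \<noteq> 0)" for x
  define G where "G = (\<lambda>i. L (a i)) ` {1..n} \<union> (\<lambda>i. L (b i)) ` {1..n}"
  have "finite G" by (simp add: G_def)
  have "(\<Sum>i=1..n. \<bar>glue \<phi> (b i) - glue \<phi> (a i)\<bar> powr p / \<Lambda> i)
      \<le> (\<Sum>i=1..n. (\<Sum>l\<in>G. \<bar>\<phi> l (b i) - \<phi> l (a i)\<bar> powr p) / \<Lambda> i)"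
  proof (intro sum_mono divide_right_mono glue_increment_powr_le[OF disj supp nonneg])
    fix i assume i: "i \<in> {1..n}"
    then show "(SOME l. \<phi> l (a i) \<noteq> 0) \<in> G" "(SOME l. \<phi> l (b i) \<noteq> 0) \<in> G"
      by (auto simp: G_def L_def)
    show "0 \<le> \<Lambda> i" using i \<Lambda>_pos[of i] by auto
  qed (use p \<open>finite G\<close> in auto)
  also have "\<dots> = (\<Sum>l\<in>G. \<Sum>i=1..n. \<bar>\<phi> l (b i) - \<phi> l (a i)\<bar> powr p / \<Lambda> i)"
    by (subst sum.swap) (simp add: sum_divide_distrib)
  also have "\<dots> \<le> sum c G"
    using c ab unfolding endpoint_variation_bound_def by (intro sum_mono) blast
  also have "\<dots> \<le> C" by (rule C[OF \<open>finite G\<close>])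
  finally show "(\<Sum>i=1..n. \<bar>glue \<phi> (b i) - glue \<phi> (a i)\<bar> powr p / \<Lambda> i) \<le> C" .
qed

text \<open>
  A lower bound needs more than the pointwise estimate: a nonintegrable function has integral 0, so the
  measurability and boundedness of \<^term>\<open>f\<close> are needed.
\<close>

lemma integral_shift_powr_ge:
  assumes K: "endpoint_variation_bound \<Lambda> p f K"
    and \<gamma>: "0 \<le> \<gamma>" and h: "0 \<le> h" and ab: "0 \<le> a" "a \<le> b" "b \<le> 1 - \<gamma>"
    and inc: "\<And>t. a \<le> t \<Longrightarrow> t < b \<Longrightarrow> h \<le> \<bar>f (t + \<gamma>) - f t\<bar>"
  shows "h powr q * (b - a) \<le> (LINT t|lebesgue_on {0..1 - \<gamma>}. \<bar>f (t + \<gamma>) - f t\<bar> powr q)"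
proof -
  let ?M = "lebesgue_on {0..1 - \<gamma>}"
  obtain B where B: "\<And>x. x \<in> {0..1} \<Longrightarrow> \<bar>f x\<bar> \<le> B"
    using bounded_if_endpoint_variation_bound[OF p \<Lambda>_pos[OF order_refl] K] by blast
  interpret finite_measure ?M by (rule finite_measure_lebesgue_on) auto
  have [measurable]: "clamped f \<in> borel_measurable borel"
    by (rule borel_measurable_clamped[OF \<Lambda>_pos divergent p K])
  have "(\<lambda>t. \<bar>clamped f (t + \<gamma>) - clamped f t\<bar> powr q) \<in> borel_measurable borel" by measurable
  then have "(\<lambda>t. \<bar>clamped f (t + \<gamma>) - clamped f t\<bar> powr q) \<in> borel_measurable ?M"
    by (simp add: measurable_completion measurable_restrict_space1)
  then have meas: "(\<lambda>t. \<bar>f (t + \<gamma>) - f t\<bar> powr q) \<in> borel_measurable ?M"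
    using \<gamma> by (subst measurable_cong[where g = "\<lambda>t. \<bar>clamped f (t + \<gamma>) - clamped f t\<bar> powr q"]) auto
  have int: "integrable ?M (\<lambda>t. \<bar>f (t + \<gamma>) - f t\<bar> powr q)"
  proof (rule integrable_const_bound[where B = "(2 * B) powr q", OF AE_I2 meas])
    fix t assume "t \<in> space ?M"
    then have "\<bar>f (t + \<gamma>)\<bar> \<le> B" "\<bar>f t\<bar> \<le> B" using \<gamma> by (auto intro!: B)
    then show "norm (\<bar>f (t + \<gamma>) - f t\<bar> powr q) \<le> (2 * B) powr q"
      using q by (auto intro!: powr_mono2)
  qed
  have E: "{a..<b} \<in> sets ?M" "{a..<b} \<subseteq> {0..1 - \<gamma>}"
    using ab by (auto simp: sets_restrict_space_iff)
  have "h powr q * (b - a) = (LINT t|?M. h powr q * indicator {a..<b} t)"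
    using ab E by (simp add: measure_restrict_space Int_absorb2)
  also have "\<dots> \<le> (LINT t|?M. \<bar>f (t + \<gamma>) - f t\<bar> powr q)"
  proof (rule integral_mono[OF _ int])
    show "integrable ?M (\<lambda>t. h powr q * indicator {a..<b} t)"
      using E(1) by (intro integrable_mult_right integrable_real_indicator) (auto simp: emeasure_finite less_top[symmetric])
    fix t
    show "h powr q * indicator {a..<b} t \<le> \<bar>f (t + \<gamma>) - f t\<bar> powr q"
      using inc[of t] h q by (auto simp: indicator_def intro!: powr_mono2)
  qed
  finally show ?thesis .
qed

section \<open>Necessity of the criterion\<close>

text \<open>
  The bumps have to fit into an interval of length \<open>1 / 2 ^ (l + 1)\<close>. The optimal number \<open>k\<close> of bumps may be
  too large for it, but truncating it loses at most a factor \<open>2 ^ (l + 2)\<close>, since a smaller \<open>k\<close> also has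
  a smaller \<^term>\<open>recip_sum k\<close>. Starting from an excess \<open>8\<^sup>l\<close> in the criterion leaves \<open>4\<^sup>l / 4\<close>, enough to
  absorb a further factor \<open>2\<^sup>l\<close> later.
\<close>

lemma ex_efficient_bumps:
  assumes unbounded: "\<And>C n0. \<exists>n\<ge>n0. C * \<omega> (1 / real n) < max_ratio n / real n powr (1 / q)"
  shows "\<exists>n k. 2 ^ (l + 1) \<le> n \<and> 1 \<le> k \<and> real k / real n \<le> 1 / 2 ^ (l + 1) \<and>
           2 ^ l * 2 ^ l / 4 * \<omega> (1 / real n) < (real k / real n) powr (1 / q) / recip_sum k powr (1 / p)"
proof -
  obtain n where n: "2 ^ (l + 1) \<le> n" and big: "8 ^ l * \<omega> (1 / real n) < max_ratio n / real n powr (1 / q)"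
    using unbounded by blast
  have n1: "1 \<le> n" using n by (metis one_le_numeral one_le_power order_trans)
  obtain k0 where k0: "1 \<le> k0" "k0 \<le> n" "max_ratio n = real k0 powr (1 / q) / recip_sum k0 powr (1 / p)"
    using max_ratio_attained[OF n1] by blast
  \<comment> \<open>The number of periods \<open>1 / n\<close> that fit into the interval.\<close>
  define m where "m = n div 2 ^ (l + 1)"
  define k where "k = min k0 m"
  have m1: "1 \<le> m" using n by (simp add: m_def div_greater_zero_iff Suc_le_eq)
  have k1: "1 \<le> k" "k \<le> k0" using k0 m1 by (auto simp: k_def)
  have "k * 2 ^ (l + 1) \<le> m * 2 ^ (l + 1)" by (simp add: k_def)
  also have "\<dots> \<le> n" unfolding m_def by (rule div_times_less_eq_dividend)
  finally have "real (k * 2 ^ (l + 1)) \<le> real n" by (simp only: of_nat_le_iff)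
  then have kn: "real k / real n \<le> 1 / 2 ^ (l + 1)" using n1 by (simp add: field_simps)
  have "n < (m + 1) * 2 ^ (l + 1)"
    unfolding m_def by (metis Suc_eq_plus1 dividend_less_div_times mult.commute mult_Suc pos2 zero_less_power)
  also have "\<dots> \<le> (2 * m) * 2 ^ (l + 1)" using m1 by (intro mult_right_mono) auto
  finally have "n < m * 2 ^ (l + 2)" by simp
  then have "k0 \<le> k * 2 ^ (l + 2)" using k0(2) by (auto simp: k_def min_def)
  then have "real k0 \<le> real (k * 2 ^ (l + 2))" by (simp only: of_nat_le_iff)
  then have ratio: "real k0 / real n \<le> (real k / real n) * 2 ^ (l + 2)"
    using n1 by (simp add: divide_right_mono)
  have "8 ^ l * \<omega> (1 / real n) < (real k0 / real n) powr (1 / q) / recip_sum k0 powr (1 / p)"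
    using big k0 by (simp add: powr_divide field_simps)
  also have "\<dots> \<le> ((real k / real n) * 2 ^ (l + 2)) powr (1 / q) / recip_sum k powr (1 / p)"
    using ratio recip_sum_pos[OF k1(1)] recip_sum_mono[OF k1(2)] p q by (intro frac_le powr_mono2) auto
  also have "\<dots> = (2 ^ (l + 2)) powr (1 / q) * ((real k / real n) powr (1 / q) / recip_sum k powr (1 / p))"
    by (subst powr_mult) (simp only: times_divide_eq_right mult.commute)
  also have "\<dots> \<le> 2 ^ (l + 2) * ((real k / real n) powr (1 / q) / recip_sum k powr (1 / p))"
  proof (rule mult_right_mono)
    have "((2::real) ^ (l + 2)) powr (1 / q) \<le> (2 ^ (l + 2)) powr 1"
      using q by (intro powr_mono one_le_power) auto
    then show "((2::real) ^ (l + 2)) powr (1 / q) \<le> 2 ^ (l + 2)" by simp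
  qed simp
  finally have "8 ^ l * \<omega> (1 / real n) / 2 ^ (l + 2) < (real k / real n) powr (1 / q) / recip_sum k powr (1 / p)"
    by (simp add: divide_less_eq mult.commute)
  moreover have "(8::real) ^ l = 2 ^ l * 2 ^ l * 2 ^ l"
    by (simp flip: power_mult_distrib)
  ultimately show ?thesis using n k1 kn by (intro exI[of _ n] exI[of _ k]) simp
qed

text \<open>
  The function consists of trains of bumps, the \<open>l\<close>-th one with period \<open>1 / n\<^sub>l\<close>, placed in the dyadic interval
  \<open>[1 / 2 ^ (l + 1), 1 / 2 ^ l)\<close>. The height \<open>h\<^sub>l\<close> gives the \<open>l\<close>-th train variation at most
  \<open>2 / 2\<^sup>l\<close> (before taking the \<open>p\<close>-th root), so the total is finite. Because the trains occupy
  disjoint places, the integral modulus at \<open>1 / n\<^sub>l\<close> is bounded below by the contribution of the \<open>l\<close>-th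
  train alone, and nothing has to be subtracted for the other ones. It exceeds
  \<open>2\<^sup>l / 8\<close> times \<open>\<omega> (1 / n\<^sub>l)\<close>.
\<close>

lemma not_Waterman_Shiba_subset_H_class_if:
  assumes \<omega>: "\<And>n. 0 \<le> \<omega> (1 / real n)"
    and unbounded: "\<And>C n0. \<exists>n\<ge>n0. C * \<omega> (1 / real n) < max_ratio n / real n powr (1 / q)"
  shows "\<not> Waterman_Shiba \<Lambda> p \<subseteq> H_class \<omega> q"
proof
  assume sub: "Waterman_Shiba \<Lambda> p \<subseteq> H_class \<omega> q"
  obtain n k where nk: "\<And>l. 2 ^ (l + 1) \<le> n l" "\<And>l. 1 \<le> k l"
    "\<And>l. real (k l) / real (n l) \<le> 1 / 2 ^ (l + 1)"
    "\<And>l. 2 ^ l * 2 ^ l / 4 * \<omega> (1 / real (n l)) < (real (k l) / real (n l)) powr (1 / q) / recip_sum (k l) powr (1 / p)"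
    using ex_efficient_bumps[OF unbounded] by metis
  have n1: "1 \<le> n l" for l
    using nk(1)[of l] by (metis one_le_numeral one_le_power order_trans)
  define a where "a l = 1 / (2::real) ^ (l + 1)" for l
  define h where "h l = 1 / (2 ^ l * recip_sum (k l) powr (1 / p))" for l
  define \<phi> where "\<phi> l t = h l * bumps (a l) (n l) (k l) t" for l t
  define J where "J l = {a l..<2 * a l}" for l
  define f where "f = glue \<phi>"
  have a0: "0 < a l" and a1: "2 * a l \<le> 1" for l by (auto simp: a_def)
  have h0: "0 < h l" for l using recip_sum_pos[OF nk(2)[of l]] by (simp add: h_def)
  have "2 * a l' \<le> a l" if "l < l'" for l l'
  proof -
    have "(2::real) ^ (l + 1) \<le> 2 ^ l'" using that by (intro power_increasing) auto
    then show ?thesis by (simp add: a_def field_simps)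
  qed
  then have "J l \<inter> J l' = {}" if "l < l'" for l l'
    using that by (fastforce simp: J_def)
  then have disj: "disjoint_family J"
    unfolding disjoint_family_on_def by (metis Int_commute linorder_neqE_nat)
  have supp: "t \<in> J l" if "\<phi> l t \<noteq> 0" for l t
    using bumps_support[OF _ n1[of l], of "a l" "k l" t] that nk(3)[of l]
    by (auto simp: \<phi>_def J_def a_def)
  have bound: "endpoint_variation_bound \<Lambda> p f 4"
    unfolding f_def
  proof (rule endpoint_variation_bound_glue[OF disj supp])
    show "0 \<le> \<phi> l t" for l t using h0[of l] by (simp add: \<phi>_def bumps_nonneg)
    show "endpoint_variation_bound \<Lambda> p (\<phi> l) (2 * h l powr p * recip_sum (k l))" for l
      unfolding \<phi>_def using h0[of l] by (intro endpoint_variation_bound_bumps n1) auto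
    fix G :: "nat set" assume G: "finite G"
    have "2 * h l powr p * recip_sum (k l) \<le> 2 * (1 / 2) ^ l" for l
    proof -
      have "h l powr p = (1 / 2 ^ l) powr p * (1 / recip_sum (k l))"
        using p recip_sum_pos[OF nk(2)[of l]] by (simp add: h_def powr_divide powr_mult powr_powr)
      then have "2 * h l powr p * recip_sum (k l) = 2 * (1 / 2 ^ l) powr p"
        using recip_sum_pos[OF nk(2)[of l]] by simp
      also have "(1 / 2 ^ l) powr p \<le> (1 / 2 ^ l :: real) powr 1"
        using p by (intro powr_mono') auto
      finally show ?thesis by (simp add: power_one_over)
    qed
    then have "(\<Sum>l\<in>G. 2 * h l powr p * recip_sum (k l)) \<le> (\<Sum>l\<in>G. 2 * (1 / 2) ^ l)"
      by (rule sum_mono)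
    also have "\<dots> \<le> (\<Sum>l. 2 * (1 / 2 :: real) ^ l)"
      by (intro sum_le_suminf summable_mult summable_geometric G) auto
    also have "\<dots> = 4"
      by (simp add: suminf_mult suminf_geometric)
    finally show "(\<Sum>l\<in>G. 2 * h l powr p * recip_sum (k l)) \<le> 4" .
  qed
  then have "f \<in> H_class \<omega> q"
    using sub Waterman_Shiba_iff_endpoint_variation[of p \<Lambda> f, OF p \<Lambda>_pos] by blast
  then have "(\<lambda>\<delta>. integral_modulus q \<delta> f) \<in> O[at_right 0](\<omega>)"
    by (simp add: H_class_def)
  then obtain c where "0 < c"
    and "eventually (\<lambda>\<delta>. norm (integral_modulus q \<delta> f) \<le> c * norm (\<omega> \<delta>)) (at_right 0)"
    by (elim landau_o.bigE)
  then obtain d where d: "0 < d"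
    and upper: "\<And>\<delta>. 0 < \<delta> \<Longrightarrow> \<delta> < d \<Longrightarrow> \<bar>integral_modulus q \<delta> f\<bar> \<le> c * \<bar>\<omega> \<delta>\<bar>"
    by (auto simp: eventually_at_right_field)
  obtain l where l: "max (8 * c) (1 / d) < (2::real) ^ l"
    using real_arch_pow[of 2 "max (8 * c) (1 / d)"] by auto
  \<comment> \<open>Translation by half a period of the \<open>l\<close>-th train.\<close>
  define \<gamma> where "\<gamma> = 1 / (2 * real (n l))"
  have \<gamma>: "0 < \<gamma>" "2 * \<gamma> = 1 / real (n l)" "\<gamma> \<le> 1 / real (n l)"
    using n1[of l] by (auto simp: \<gamma>_def field_simps)
  have small: "1 / real (n l) < d"
  proof -
    have "1 / d < 2 ^ l" using l by simp
    also have "(2::real) ^ l \<le> real (2 ^ (l + 1))" by simp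
    also have "\<dots> \<le> real (n l)" using nk(1)[of l] by (simp only: of_nat_le_iff)
    finally show ?thesis using d n1[of l] by (simp add: field_simps)
  qed
  \<comment> \<open>Up to here a translated point stays inside the train.\<close>
  define b where "b = a l + (2 * real (k l) - 1) * \<gamma>"
  have top: "b + \<gamma> \<le> 2 * a l"
  proof -
    have "b + \<gamma> = a l + real (k l) * (2 * \<gamma>)" by (simp add: b_def algebra_simps)
    also have "\<dots> = a l + real (k l) / real (n l)" unfolding \<gamma>(2) by simp
    finally show ?thesis using nk(3)[of l] by (simp add: a_def)
  qed
  have len: "real (k l) * \<gamma> \<le> b - a l"
    using nk(2)[of l] \<gamma>(1) by (simp add: b_def)
  have ab: "a l \<le> b"
  proof -
    have "0 \<le> real (k l) * \<gamma>" using \<gamma>(1) by simp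
    with len show ?thesis by linarith
  qed
  have "h l powr q * (real (k l) * \<gamma>) \<le> h l powr q * (b - a l)"
    using len by (intro mult_left_mono) auto
  also have "\<dots> \<le> (LINT t|lebesgue_on {0..1 - \<gamma>}. \<bar>f (t + \<gamma>) - f t\<bar> powr q)"
  proof (rule integral_shift_powr_ge[OF bound])
    fix t assume t: "a l \<le> t" "t < b"
    then have "t \<in> J l" "t + \<gamma> \<in> J l" using top \<gamma> by (auto simp: J_def)
    then have "f t = \<phi> l t" "f (t + \<gamma>) = \<phi> l (t + \<gamma>)"
      unfolding f_def by (auto intro!: glue_eq[OF disj supp])
    moreover have "\<bar>bumps (a l) (n l) (k l) (t + \<gamma>) - bumps (a l) (n l) (k l) t\<bar> = 1"
      unfolding \<gamma>_def using t by (intro bumps_shift n1) (auto simp: b_def \<gamma>_def)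
    ultimately show "h l \<le> \<bar>f (t + \<gamma>) - f t\<bar>"
      using h0[of l] by (simp add: \<phi>_def abs_mult flip: right_diff_distrib)
  qed (use \<gamma>(1) h0[of l] a0[of l] a1[of l] top ab in auto)
  finally have "(h l powr q * (real (k l) * \<gamma>)) powr (1 / q)
      \<le> (LINT t|lebesgue_on {0..1 - \<gamma>}. \<bar>f (t + \<gamma>) - f t\<bar> powr q) powr (1 / q)"
    using q \<gamma> by (intro powr_mono2) auto
  also have "\<dots> \<le> integral_modulus q (1 / real (n l)) f"
    using \<gamma> n1[of l] by (intro integral_modulus_ge[OF bound]) auto
  also have "\<dots> \<le> c * \<omega> (1 / real (n l))"
    using upper[OF _ small] n1[of l] \<omega>[of "n l"] by auto
  also have "\<dots> \<le> 2 ^ l / 8 * \<omega> (1 / real (n l))"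
    using l \<omega> by (intro mult_right_mono) auto
  also have "(h l powr q * (real (k l) * \<gamma>)) powr (1 / q)
      = (1 / 2) powr (1 / q) * (h l * (real (k l) / real (n l)) powr (1 / q))"
    using q h0[of l] by (simp add: \<gamma>_def powr_mult powr_divide powr_powr)
  finally have "(1 / 2) powr (1 / q) * (h l * (real (k l) / real (n l)) powr (1 / q))
      \<le> 2 ^ l / 8 * \<omega> (1 / real (n l))" .
  moreover have "1 / 2 * (h l * (real (k l) / real (n l)) powr (1 / q))
      \<le> (1 / 2) powr (1 / q) * (h l * (real (k l) / real (n l)) powr (1 / q))"
    using powr_mono'[of "1 / q" 1 "1 / 2"] q h0[of l] by (intro mult_right_mono) auto
  moreover have "h l * (real (k l) / real (n l)) powr (1 / q)
      = (1 / 2 ^ l) * ((real (k l) / real (n l)) powr (1 / q) / recip_sum (k l) powr (1 / p))"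
    by (simp add: h_def)
  moreover have "(1 / 2 ^ l) * (2 ^ l * 2 ^ l / 4 * \<omega> (1 / real (n l)))
      < (1 / 2 ^ l) * ((real (k l) / real (n l)) powr (1 / q) / recip_sum (k l) powr (1 / p))"
    using nk(4)[of l] by (intro mult_strict_left_mono) auto
  moreover have "(1 / 2 ^ l) * (2 ^ l * 2 ^ l / 4 * \<omega> (1 / real (n l))) = 2 * (2 ^ l / 8 * \<omega> (1 / real (n l)))"
    by simp
  ultimately show False by linarith
qed

text \<open>
  The quotient in the criterion is infinite when \<open>\<omega> (1 / n) = 0\<close>; correspondingly the linear inequality
  fails then, because \<^term>\<open>max_ratio n\<close> is positive.
\<close>

lemma limsup_finite_iff:
  assumes \<omega>: "\<And>n. 0 \<le> \<omega> (1 / real n)"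
  shows "limsup (\<lambda>n. if \<omega> (1 / real n) = 0 then \<infinity>
      else ereal (1 / (\<omega> (1 / real n) * real n powr (1 / q)) * max_ratio n)) < \<infinity> \<longleftrightarrow>
    (\<exists>C. eventually (\<lambda>n. max_ratio n / real n powr (1 / q) \<le> C * \<omega> (1 / real n)) sequentially)"
    (is "limsup ?X < \<infinity> \<longleftrightarrow> _")
proof -
  have X: "?X n \<le> ereal C \<longleftrightarrow> max_ratio n / real n powr (1 / q) \<le> C * \<omega> (1 / real n)" if "1 \<le> n" for n C
    using \<omega>[of n] max_ratio_pos[OF that] that
    by (cases "\<omega> (1 / real n) = 0") (auto simp: field_simps)
  have "limsup ?X < \<infinity> \<longleftrightarrow> (\<exists>C. eventually (\<lambda>n. ?X n \<le> ereal C) sequentially)"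
  proof
    assume "limsup ?X < \<infinity>"
    then obtain C where "limsup ?X < ereal C"
      using ereal_dense2 by blast
    then have "eventually (\<lambda>n. ?X n < ereal C) sequentially" by (rule Limsup_lessD)
    then show "\<exists>C. eventually (\<lambda>n. ?X n \<le> ereal C) sequentially"
      by (auto elim!: eventually_mono intro!: exI[of _ C] less_imp_le)
  next
    assume "\<exists>C. eventually (\<lambda>n. ?X n \<le> ereal C) sequentially"
    then obtain C where "eventually (\<lambda>n. ?X n \<le> ereal C) sequentially" ..
    then have "limsup ?X \<le> ereal C" by (rule Limsup_bounded)
    then show "limsup ?X < \<infinity>" by auto
  qed
  also have "\<dots> \<longleftrightarrow> (\<exists>C. eventually (\<lambda>n. max_ratio n / real n powr (1 / q) \<le> C * \<omega> (1 / real n)) sequentially)"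
    by (intro ex_cong1 eventually_cong eventually_mono[OF eventually_ge_at_top[of 1]] X)
  finally show ?thesis .
qed

end

section \<open>The characterisation\<close>

theorem theorem2p2:
  fixes p q :: real and \<Lambda> :: "nat \<Rightarrow> real" and \<omega> :: "real \<Rightarrow> real"
  assumes "1 \<le> p" and "1 \<le> q"
    and "mono_on {1..} \<Lambda>"
    and "\<And>i. 1 \<le> i \<Longrightarrow> 0 < \<Lambda> i"
    and "filterlim (\<lambda>n. \<Sum>i=1..n. 1 / \<Lambda> i) at_top sequentially"
    and "modulus_of_continuity \<omega>"
  shows "Waterman_Shiba \<Lambda> p \<subseteq> H_class \<omega> q \<longleftrightarrow>
    limsup (\<lambda>n. if \<omega> (1 / real n) = 0 then \<infinity>
      else ereal (1 / (\<omega> (1 / real n) * real n powr (1 / q)) *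
        (MAX k\<in>{1..n}. real k powr (1 / q) / (\<Sum>i=1..k. 1 / \<Lambda> i) powr (1 / p)))) < \<infinity>"
proof -
  interpret waterman_shiba \<Lambda> p q
    using assms by unfold_locales
  have \<omega>: "0 \<le> \<omega> (1 / real n)" for n
  proof -
    have "\<omega> 0 \<le> \<omega> (1 / real n)"
      using assms(6) mono_onD[of "{0..1}" \<omega> 0 "1 / real n"]
      by (cases "n = 0") (auto simp: modulus_of_continuity_def)
    then show ?thesis using assms(6) by (simp add: modulus_of_continuity_def)
  qed
  have "Waterman_Shiba \<Lambda> p \<subseteq> H_class \<omega> q \<longleftrightarrow>
    (\<exists>C. eventually (\<lambda>n. max_ratio n / real n powr (1 / q) \<le> C * \<omega> (1 / real n)) sequentially)"
    using Waterman_Shiba_subset_H_class_if[OF assms(6)] not_Waterman_Shiba_subset_H_class_if[of \<omega>, OF \<omega>]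
    unfolding eventually_sequentially by (meson not_le)
  also note limsup_finite_iff[of \<omega>, OF \<omega>, symmetric]
  finally show ?thesis unfolding max_ratio_def recip_sum_def .
qed

end
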